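(* Let $f\in\mathcal{B}$ be of finite order $\rho(f)$. Suppose that $$\operatorname{logarea}\left\{ z\in\Delta : |f(z)| < \exp\left(|z|^{\rho(f)/2+\varepsilon}\right) \right\} <\infty$$ for some $\varepsilon>0$. Then $$\operatorname{logarea}(\Delta\setminus A(f))<\infty.$$
   Context: The Eremenko-Lyubich class $\mathcal{B}$ is the class of all transcendental entire functions $f$ for which the set of critical values and (finite) asymptotic values is bounded. $f^n$ denotes the $n$-th iterate of $f$. Let $M(r,f)=\max_{|z|=r}|f(z)|$. The order of $f$ is $\rho(f)=\limsup_{r\to\infty}\frac{\log\log M(r,f)}{\log r}$. Let $M^1(r,f)=M(r,f)$ and $M^n(r,f)=M(M^{n-1}(r,f),f)$ for $n\ge 2$. There exists $R>0$ such that $M(r,f)>r$ for all $r\ge R$; with such an $R$, the fast escaping set $A(f)$ is the set of all $z\in\mathbb{C}$ for which there exists $L\in\mathbb{N}$ such that $|f^n(z)|\ge M^{n-L}(R,f)$ for all $n>L$. (The definition is independent of the choice of $R$.) The logarithmic area of a measurable set $A\subset\mathbb{C}$ is $\operatorname{logarea} A=\int_A \frac{dx\,dy}{|z|^2}$ (with $z=x+iy$), and $\Delta=\{z\in\mathbb{C}: |z|\ge 1\}$. *)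

theory Defs
  imports
    "HOL-Complex_Analysis.Complex_Analysis"
    "HOL-Computational_Algebra.Polynomial"
begin

section \<open>The Eremenko--Lyubich class\<close>

definition transcendental_entire :: "(complex \<Rightarrow> complex) \<Rightarrow> bool" where
  "transcendental_entire f \<longleftrightarrow> f holomorphic_on UNIV \<and> (\<nexists>p. \<forall>z. f z = poly p z)"

definition critical_values :: "(complex \<Rightarrow> complex) \<Rightarrow> complex set" where
  "critical_values f = {f z | z. deriv f z = 0}"

definition asymptotic_values :: "(complex \<Rightarrow> complex) \<Rightarrow> complex set" where
  "asymptotic_values f =
     {a. \<exists>\<gamma> :: real \<Rightarrow> complex.
        continuous_on {0..} \<gamma> \<and> filterlim \<gamma> at_infinity at_top \<and> ((\<lambda>t. f (\<gamma> t)) \<longlongrightarrow> a) at_top}"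

definition eremenko_lyubich :: "(complex \<Rightarrow> complex) set" where
  "eremenko_lyubich =
     {f. transcendental_entire f \<and> bounded (critical_values f \<union> asymptotic_values f)}"


section \<open>Maximum modulus, order, and the fast escaping set\<close>

definition max_modulus :: "(complex \<Rightarrow> complex) \<Rightarrow> real \<Rightarrow> real" where
  "max_modulus f r = (SUP z\<in>sphere 0 r. cmod (f z))"

definition growth_order :: "(complex \<Rightarrow> complex) \<Rightarrow> ereal" where
  "growth_order f = Limsup at_top (\<lambda>r. ereal (ln (ln (max_modulus f r)) / ln r))"

definition admissible_radius :: "(complex \<Rightarrow> complex) \<Rightarrow> real \<Rightarrow> bool" where
  "admissible_radius f R \<longleftrightarrow> R > 0 \<and> (\<forall>r\<ge>R. max_modulus f r > r)"

definition fast_escaping_wrt :: "(complex \<Rightarrow> complex) \<Rightarrow> real \<Rightarrow> complex set" where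
  "fast_escaping_wrt f R =
     {z. \<exists>L::nat. \<forall>n>L. cmod ((f ^^ n) z) \<ge> (max_modulus f ^^ (n - L)) R}"

text \<open>
  For transcendental entire \<open>f\<close> an admissible radius exists (\<open>ex_admissible_radius\<close>) and
  the set does not depend on the one chosen (\<open>fast_escaping_set_eq\<close>).
\<close>

definition fast_escaping_set :: "(complex \<Rightarrow> complex) \<Rightarrow> complex set" where
  "fast_escaping_set f = fast_escaping_wrt f (SOME R. admissible_radius f R)"

lemma max_modulus_bdd:
  assumes "f holomorphic_on UNIV"
  shows "bdd_above ((\<lambda>z. cmod (f z)) ` sphere 0 r)"
proof -
  have "continuous_on (sphere 0 r) (\<lambda>z. cmod (f z))"
    using holomorphic_on_imp_continuous_on[OF assms]
    by (intro continuous_intros) (auto intro: continuous_on_subset)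
  then have "compact ((\<lambda>z. cmod (f z)) ` sphere 0 r)"
    by (intro compact_continuous_image) auto
  then show ?thesis
    by (simp add: bounded_imp_bdd_above compact_imp_bounded)
qed

lemma norm_le_max_modulus:
  assumes "f holomorphic_on UNIV" "cmod z = r"
  shows "cmod (f z) \<le> max_modulus f r"
  unfolding max_modulus_def
  by (rule cSUP_upper[OF _ max_modulus_bdd[OF assms(1)]]) (use assms in auto)

lemma max_modulus_attained:
  assumes "f holomorphic_on UNIV" "0 \<le> r"
  obtains z where "cmod z = r" "max_modulus f r = cmod (f z)"
proof -
  have cont: "continuous_on (sphere 0 r) (\<lambda>z. cmod (f z))"
    using holomorphic_on_imp_continuous_on[OF assms(1)]
    by (intro continuous_intros) (auto intro: continuous_on_subset)
  have ne: "sphere (0::complex) r \<noteq> {}"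
    using assms by (auto intro!: exI[of _ "of_real r"] simp: set_eq_iff)
  obtain z where z: "z \<in> sphere 0 r" "\<And>w. w \<in> sphere 0 r \<Longrightarrow> cmod (f w) \<le> cmod (f z)"
    using continuous_attains_sup[OF _ ne cont] by auto
  have "max_modulus f r = cmod (f z)"
    unfolding max_modulus_def by (rule cSup_eq_maximum) (use z in auto)
  with z show ?thesis using that by auto
qed

lemma max_modulus_mono:
  assumes "f holomorphic_on UNIV" "0 \<le> r" "r \<le> s"
  shows "max_modulus f r \<le> max_modulus f s"
proof (cases "s = 0")
  case True
  then show ?thesis using assms by simp
next
  case False
  obtain z where z: "cmod z = r" "max_modulus f r = cmod (f z)"
    using max_modulus_attained[OF assms(1,2)] .
  have "cmod (f z) \<le> max_modulus f s"
  proof (rule maximum_modulus_frontier[of f "cball 0 s"])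
    show "f holomorphic_on interior (cball 0 s)"
      using assms(1) holomorphic_on_subset by blast
    show "continuous_on (closure (cball 0 s)) f"
      using holomorphic_on_imp_continuous_on[OF assms(1)] continuous_on_subset by blast
    show "cmod (f w) \<le> max_modulus f s" if "w \<in> frontier (cball 0 s)" for w :: complex
      using that False assms by (intro norm_le_max_modulus) (auto simp: frontier_cball)
  qed (use z assms in auto)
  with z show ?thesis by simp
qed

lemma ex_admissible_radius:
  assumes "transcendental_entire f"
  shows "\<exists>R. admissible_radius f R"
proof (rule ccontr)
  assume "\<nexists>R. admissible_radius f R"
  then have small: "\<exists>r\<ge>R. max_modulus f r \<le> r" if "R > 0" for R
    using that unfolding admissible_radius_def by (meson not_less)
  have hol: "f holomorphic_on UNIV"
    using assms by (simp add: transcendental_entire_def)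
  have bound: "cmod ((deriv ^^ k) f 0) \<le> fact k / R" if "k \<ge> 2" "R \<ge> 1" for k R
  proof -
    obtain r where r: "r \<ge> R" "max_modulus f r \<le> r"
      using small[of R] \<open>R \<ge> 1\<close> by auto
    have "cmod ((deriv ^^ k) f 0) \<le> fact k * r / r ^ k"
    proof (rule Cauchy_inequality)
      show "f holomorphic_on ball 0 r"
        using hol holomorphic_on_subset by blast
      show "continuous_on (cball 0 r) f"
        using holomorphic_on_imp_continuous_on[OF hol] continuous_on_subset by blast
      show "cmod (f x) \<le> r" if "cmod (0 - x) = r" for x
        using norm_le_max_modulus[OF hol, of x r] that r by simp
    qed (use r that in auto)
    also have "\<dots> \<le> fact k / R"
    proof -
      have "R * r \<le> r * r"
        using r that by (intro mult_right_mono) auto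
      also have "r * r = r ^ 2"
        by (simp add: power2_eq_square)
      also have "r ^ 2 \<le> r ^ k"
        using r that by (intro power_increasing) auto
      finally show ?thesis
        using r that by (simp add: field_simps)
    qed
    finally show ?thesis .
  qed
  have zero: "(deriv ^^ k) f 0 = 0" if "k \<ge> 2" for k
  proof -
    have "((\<lambda>R. fact k / R) \<longlongrightarrow> (0::real)) at_top"
      by (rule real_tendsto_divide_at_top[OF tendsto_const filterlim_ident])
    moreover have "eventually (\<lambda>R. cmod ((deriv ^^ k) f 0) \<le> fact k / R) at_top"
      using eventually_ge_at_top[of 1] by eventually_elim (use bound that in auto)
    ultimately have "cmod ((deriv ^^ k) f 0) \<le> 0"
      by (intro tendsto_lowerbound) auto
    then show ?thesis by simp
  qed
  have "f z = poly [:f 0, deriv f 0:] z" for z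
  proof -
    have 1: "(\<lambda>n. (deriv ^^ n) f 0 / fact n * (z - 0) ^ n) sums f z"
      by (rule holomorphic_power_series[of _ _ "cmod z + 1"])
        (use hol holomorphic_on_subset in auto)
    have 2: "(\<lambda>n. (deriv ^^ n) f 0 / fact n * (z - 0) ^ n) sums
          (\<Sum>n<2. (deriv ^^ n) f 0 / fact n * (z - 0) ^ n)"
      by (rule sums_finite) (auto simp: zero)
    show ?thesis
      using sums_unique2[OF 1 2] by (simp add: numeral_2_eq_2)
  qed
  then show False
    using assms unfolding transcendental_entire_def by blast
qed

lemma iterate_max_modulus_ge:
  assumes "admissible_radius f R"
  shows "(max_modulus f ^^ n) R \<ge> R"
proof (induction n)
  case (Suc n)
  then have "max_modulus f ((max_modulus f ^^ n) R) > (max_modulus f ^^ n) R"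
    using assms by (auto simp: admissible_radius_def)
  with Suc show ?case by simp
qed simp

lemma iterate_max_modulus_mono:
  assumes "f holomorphic_on UNIV" "admissible_radius f R" "R \<le> S"
  shows "(max_modulus f ^^ n) R \<le> (max_modulus f ^^ n) S"
proof (induction n)
  case (Suc n)
  have "0 \<le> (max_modulus f ^^ n) R"
    using iterate_max_modulus_ge[OF assms(2), of n] assms(2)
    by (auto simp: admissible_radius_def)
  with Suc show ?case
    using max_modulus_mono[OF assms(1)] by simp
qed (use assms in simp)

lemma iterate_max_modulus_unbounded:
  assumes hol: "f holomorphic_on UNIV" and adm: "admissible_radius f R"
  shows "\<exists>k. (max_modulus f ^^ k) R \<ge> B"
proof (rule ccontr)
  define a where "a = (\<lambda>k. (max_modulus f ^^ k) R)"
  assume "\<not> ?thesis"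
  then have bnd: "a k \<le> B" for k
    by (auto simp: a_def not_le less_imp_le)
  have aR: "a k \<ge> R" for k
    unfolding a_def by (rule iterate_max_modulus_ge[OF adm])
  have R: "R > 0"
    using adm by (simp add: admissible_radius_def)
  have inc: "incseq a"
    using adm aR by (intro incseq_SucI) (auto simp: a_def admissible_radius_def less_imp_le)
  obtain l where l: "a \<longlonglongrightarrow> l" "\<And>k. a k \<le> l"
    using incseq_convergent[OF inc, of B] bnd by auto
  have "l \<ge> R"
    using l(2)[of 0] aR[of 0] by linarith
  then have l0: "l > 0" and Ml: "max_modulus f l > l"
    using R adm by (auto simp: admissible_radius_def)
  obtain z where z: "cmod z = l" "max_modulus f l = cmod (f z)"
    using max_modulus_attained[OF hol, of l] l0 by auto
  have "isCont f z"
    using holomorphic_on_imp_continuous_on[OF hol] continuous_on_eq_continuous_at by blast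
  moreover have "(\<lambda>k. of_real (a k / l) * z) \<longlonglongrightarrow> z"
  proof -
    have "(\<lambda>k. of_real (a k / l) * z) \<longlonglongrightarrow> of_real (l / l) * z"
      using l0 by (intro tendsto_intros l(1)) auto
    then show ?thesis using l0 by simp
  qed
  ultimately have "(\<lambda>k. cmod (f (of_real (a k / l) * z))) \<longlonglongrightarrow> cmod (f z)"
    by (rule tendsto_norm[OF isCont_tendsto_compose])
  moreover have "cmod (f (of_real (a k / l) * z)) \<le> l" for k
  proof -
    have "cmod (of_real (a k / l) * z) = a k"
      using l0 z aR[of k] R by (simp add: norm_mult norm_divide)
    then have "cmod (f (of_real (a k / l) * z)) \<le> max_modulus f (a k)"
      by (rule norm_le_max_modulus[OF hol])
    also have "\<dots> = a (Suc k)"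
      by (simp add: a_def)
    finally show ?thesis
      using l(2)[of "Suc k"] by linarith
  qed
  ultimately have "cmod (f z) \<le> l"
    by (intro LIMSEQ_le_const2) auto
  with z Ml show False by simp
qed

lemma fast_escaping_wrt_cong_le:
  assumes hol: "f holomorphic_on UNIV"
    and adm: "admissible_radius f R" "admissible_radius f S" and le: "R \<le> S"
  shows "fast_escaping_wrt f R = fast_escaping_wrt f S"
proof (rule equalityI; rule subsetI)
  fix z
  assume "z \<in> fast_escaping_wrt f S"
  then obtain L where "\<forall>n>L. cmod ((f ^^ n) z) \<ge> (max_modulus f ^^ (n - L)) S"
    unfolding fast_escaping_wrt_def by blast
  then have "\<forall>n>L. cmod ((f ^^ n) z) \<ge> (max_modulus f ^^ (n - L)) R"
    using iterate_max_modulus_mono[OF hol adm(1) le] order_trans by blast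
  then show "z \<in> fast_escaping_wrt f R"
    unfolding fast_escaping_wrt_def by blast
next
  fix z
  assume "z \<in> fast_escaping_wrt f R"
  then obtain L where L: "\<And>n. n > L \<Longrightarrow> cmod ((f ^^ n) z) \<ge> (max_modulus f ^^ (n - L)) R"
    unfolding fast_escaping_wrt_def by blast
  obtain k where k: "(max_modulus f ^^ k) R \<ge> S"
    using iterate_max_modulus_unbounded[OF hol adm(1)] by blast
  have "cmod ((f ^^ n) z) \<ge> (max_modulus f ^^ (n - (L + k))) S" if "n > L + k" for n
  proof -
    have "(max_modulus f ^^ (n - (L + k))) S
        \<le> (max_modulus f ^^ (n - (L + k))) ((max_modulus f ^^ k) R)"
      by (rule iterate_max_modulus_mono[OF hol adm(2) k])
    also have "\<dots> = (max_modulus f ^^ (n - (L + k) + k)) R"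
      by (simp add: funpow_add)
    also have "n - (L + k) + k = n - L"
      using that by simp
    also have "(max_modulus f ^^ (n - L)) R \<le> cmod ((f ^^ n) z)"
      using L that by simp
    finally show ?thesis .
  qed
  then show "z \<in> fast_escaping_wrt f S"
    unfolding fast_escaping_wrt_def by blast
qed

lemma fast_escaping_set_eq:
  assumes "transcendental_entire f" "admissible_radius f R"
  shows "fast_escaping_set f = fast_escaping_wrt f R"
proof -
  have hol: "f holomorphic_on UNIV"
    using assms by (simp add: transcendental_entire_def)
  have adm: "admissible_radius f (SOME R. admissible_radius f R)"
    using assms(2) by (rule someI)
  show ?thesis
    unfolding fast_escaping_set_def
    using fast_escaping_wrt_cong_le[OF hol] adm assms(2) by (metis linear)
qed


section \<open>Logarithmic area\<close>

definition logarea :: "complex set \<Rightarrow> ennreal" where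
  "logarea A = (\<integral>\<^sup>+z\<in>A. ennreal (1 / (cmod z)\<^sup>2) \<partial>lebesgue)"

definition Delta :: "complex set" ("\<Delta>") where
  "\<Delta> = {z. cmod z \<ge> 1}"

end

theory Submission
  imports Defs "HOL-Real_Asymp.Real_Asymp"
begin

text \<open>
  Put \<open>\<alpha> = \<rho> / 2 + \<epsilon>\<close> and \<open>\<beta> = \<rho> + \<epsilon>\<close>, so that the maximum modulus is eventually at most
  \<open>exp (r powr \<beta>)\<close> and \<open>\<beta> / \<alpha> < 2\<close>. Call a point \<open>z\<close> of large modulus good if
  \<open>exp (cmod z powr \<alpha>) \<le> cmod (f z)\<close>. The proof has two halves.

  If the whole orbit of \<open>z\<close> consists of good points, then \<open>z\<close> escapes fast. The orbit grows like
  iterates of \<open>t \<mapsto> exp (t powr \<alpha>)\<close>, the maximum modulus like iterates of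
  \<open>t \<mapsto> exp (t powr \<beta>)\<close>, and towers of exponentials absorb the difference between the two
  exponents once the orbit is given a head start of \<open>L\<close> steps
  (\<open>fast_escaping_of_iterated_growth\<close>).

  The points whose orbit leaves the good set have finite logarithmic area. The bad points
  have finite logarithmic area by hypothesis, and pulling a set back through the good set at least
  halves its logarithmic area (\<open>logarea_preimage_contraction\<close>), so the successive pull-backs of
  the bad set contribute a convergent geometric series. For the halving, let \<open>w\<close> have modulus
  \<open>exp l\<close> with \<open>l\<close> large. A good preimage \<open>z\<close> of \<open>w\<close> satisfies
  \<open>cmod z \<le> l powr (1 / \<alpha>)\<close>, and Jensen's inequality, in the crude form
  \<open>card_preimages_le\<close>, bounds the number of such \<open>z\<close> by a constant times
  \<open>l powr (\<beta> / \<alpha>)\<close>. With respect to logarithmic area, the Jacobian of the inverse branch at each of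
  them is at most a constant over \<open>l\<^sup>2\<close>, by the estimate \<open>eremenko_lyubich_expansion\<close>:
  \<open>cmod (z * f' z / f z)\<close> is at least a constant times \<open>l\<close>. Since \<open>\<beta> / \<alpha> < 2\<close>, the number of
  preimages times the Jacobian tends to zero.

  The expansion estimate comes from the bound \<open>R\<close> on the singular values. Outside the disc of radius
  \<open>R\<close> there are neither critical nor asymptotic values, so every local inverse continues along all
  curves there, and after composition with \<open>exp\<close> it becomes a map \<open>\<Phi>\<close> on the half plane
  \<open>ln R < Re w\<close> with \<open>f (\<Phi> w) = exp w\<close> (\<open>logarithmic_lift\<close>). If a logarithm \<open>G\<close> of \<open>\<Phi>\<close>
  took two values differing by \<open>2 * pi * \<i>\<close>, uniqueness of lifts would make \<open>\<Phi>\<close> periodic with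
  an imaginary period. Then \<open>\<Phi>\<close> would cover a punctured neighbourhood of infinity, \<open>f\<close> would tend
  to infinity there, and \<open>f\<close> would be a polynomial (\<open>logarithmic_lift_not_periodic\<close>). So the image
  of \<open>G\<close> contains no disc of radius \<open>7\<close>, and Bloch's theorem bounds the derivative of \<open>G\<close> at \<open>w\<close> by
  a constant over the distance \<open>Re w - ln R\<close> to the boundary. If \<open>z = \<Phi> w\<close>, this derivative is
  \<open>f z / (z * f' z)\<close> and \<open>Re w\<close> is \<open>ln (cmod (f z))\<close>.
\<close>

section \<open>Lifting maps through an entire function\<close>

lemma local_inverse_branch:
  fixes f :: "complex \<Rightarrow> complex"
  assumes "f holomorphic_on UNIV" "deriv f z \<noteq> 0"
  obtains r e g where "r > 0" "e > 0" "inj_on f (ball z r)" "g holomorphic_on ball (f z) e"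
    "\<And>w. w \<in> ball (f z) e \<Longrightarrow> g w \<in> ball z r \<and> f (g w) = w"
proof -
  obtain r where r: "r > 0" "open (f ` ball z r)" "inj_on f (ball z r)"
    using has_complex_derivative_locally_invertible[OF assms(1) UNIV_I open_UNIV assms(2)] by metis
  obtain g where g: "g holomorphic_on f ` ball z r"
    and gf: "\<And>x. x \<in> ball z r \<Longrightarrow> g (f x) = x"
    using holomorphic_has_inverse[OF holomorphic_on_subset[OF assms(1)] open_ball r(3)] by (metis subset_UNIV)
  have "f z \<in> f ` ball z r" using r(1) by simp
  then obtain e where e: "e > 0" "ball (f z) e \<subseteq> f ` ball z r"
    using r(2) open_contains_ball by meson
  show ?thesis
  proof (rule that[OF r(1) e(1) r(3)])
    show "g holomorphic_on ball (f z) e" using g e(2) holomorphic_on_subset by blast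
    show "g w \<in> ball z r \<and> f (g w) = w" if "w \<in> ball (f z) e" for w
      using that e(2) gf by (metis imageE subsetD)
  qed
qed

text \<open>
  The coincidence set is closed by continuity. It is open because \<open>f\<close> is injective near
  each value of \<open>\<Phi>\<close>.
\<close>
lemma lift_unique:
  fixes f \<Phi> \<Psi> :: "complex \<Rightarrow> complex" and S :: "complex set"
  assumes hol: "f holomorphic_on UNIV" and S: "connected S"
    and cont: "continuous_on S \<Phi>" "continuous_on S \<Psi>"
    and eq: "\<And>x. x \<in> S \<Longrightarrow> f (\<Phi> x) = f (\<Psi> x)"
    and nz: "\<And>x. x \<in> S \<Longrightarrow> deriv f (\<Phi> x) \<noteq> 0"
    and a: "a \<in> S" "\<Phi> a = \<Psi> a" and b: "b \<in> S"
  shows "\<Phi> b = \<Psi> b"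
proof -
  define T where "T = {x \<in> S. \<Phi> x - \<Psi> x = 0}"
  have cl: "closedin (top_of_set S) T"
    unfolding T_def by (intro continuous_closedin_preimage_constant continuous_intros cont)
  have op: "openin (top_of_set S) T"
  proof (subst openin_subopen, safe)
    fix x assume x: "x \<in> T"
    then have xS: "x \<in> S" and e: "\<Psi> x = \<Phi> x" by (auto simp: T_def)
    obtain r where r: "r > 0" "inj_on f (ball (\<Phi> x) r)"
      using local_inverse_branch[OF hol nz[OF xS]] by metis
    have "openin (top_of_set S) ((S \<inter> \<Phi> -` ball (\<Phi> x) r) \<inter> (S \<inter> \<Psi> -` ball (\<Phi> x) r))"
      by (intro openin_Int continuous_openin_preimage_gen cont open_ball)
    moreover have "(S \<inter> \<Phi> -` ball (\<Phi> x) r) \<inter> (S \<inter> \<Psi> -` ball (\<Phi> x) r) \<subseteq> T"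
      using r(2) eq by (auto simp: T_def inj_on_def)
    moreover have "x \<in> (S \<inter> \<Phi> -` ball (\<Phi> x) r) \<inter> (S \<inter> \<Psi> -` ball (\<Phi> x) r)"
      using xS e r(1) by simp
    ultimately show "\<exists>V. openin (top_of_set S) V \<and> x \<in> V \<and> V \<subseteq> T" by blast
  qed
  have "T = {} \<or> T = S" using S cl op unfolding connected_clopen by blast
  moreover have "a \<in> T" using a by (simp add: T_def)
  ultimately show ?thesis using b by (auto simp: T_def)
qed

definition singular_values_within :: "(complex \<Rightarrow> complex) \<Rightarrow> real \<Rightarrow> bool" where
  "singular_values_within f R \<longleftrightarrow>
     (\<forall>w \<in> critical_values f \<union> asymptotic_values f. cmod w \<le> R)"

lemma deriv_nonzero_of_large:
  assumes "singular_values_within f R" "cmod (f z) > R"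
  shows "deriv f z \<noteq> 0"
  using assms unfolding singular_values_within_def critical_values_def by force

text \<open>
  Here the absence of large asymptotic values enters. Move along the radius towards the
  boundary point \<open>b\<close> and look at the path of its lifts, whose image under \<open>f\<close> tends to \<open>p b\<close>. If
  the path went to infinity, \<open>p b\<close> would be an asymptotic value. Otherwise it accumulates at some
  finite \<open>z\<close> with \<open>f z = p b\<close>, which is not a critical point, and the local inverse of \<open>f\<close> at \<open>z\<close>
  composed with \<open>p\<close> continues the lift beyond \<open>b\<close>.
\<close>
lemma lift_boundary_point:
  fixes f p \<Phi> :: "complex \<Rightarrow> complex" and c :: complex
  assumes hol: "f holomorphic_on UNIV" and sv: "singular_values_within f R"
    and S: "open S" "p holomorphic_on S" "\<And>x. x \<in> S \<Longrightarrow> cmod (p x) > R"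
    and t: "t > 0" "cball c t \<subseteq> S"
    and \<Phi>: "\<Phi> holomorphic_on ball c t" "\<And>x. x \<in> ball c t \<Longrightarrow> f (\<Phi> x) = p x"
    and b: "dist c b = t"
  shows "\<exists>d \<Psi>. d > 0 \<and> ball b d \<subseteq> S \<and> \<Psi> holomorphic_on ball b d \<and>
      (\<forall>x \<in> ball b d. f (\<Psi> x) = p x) \<and> (\<forall>x \<in> ball b d \<inter> ball c t. \<Psi> x = \<Phi> x)"
proof -
  \<comment> \<open>The radius is parametrised by the half line, as required for the curves defining asymptotic values.\<close>
  define l where "l = (\<lambda>s::real. c + of_real (s / (1 + s)) * (b - c))"
  have lin: "l s \<in> ball c t" if "s \<ge> 0" for s
  proof -
    have "dist c (l s) = s / (1 + s) * t"
      using that b unfolding l_def dist_norm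
      by (simp del: of_real_divide add: norm_mult norm_minus_commute[of c])
    also have "\<dots> < t" using that t by (simp add: divide_simps)
    finally show ?thesis by simp
  qed
  have contl: "continuous_on {0..} l"
    unfolding l_def by (intro continuous_intros) auto
  have "((\<lambda>s::real. s / (1 + s)) \<longlongrightarrow> 1) at_top" by real_asymp
  then have "(l \<longlongrightarrow> c + of_real 1 * (b - c)) at_top"
    unfolding l_def by (intro tendsto_intros)
  then have liml: "(l \<longlongrightarrow> b) at_top" by simp
  have bS: "b \<in> S" using b t by auto
  have contp: "isCont p b"
    using S(1,2) bS holomorphic_on_imp_continuous_on continuous_on_eq_continuous_at by blast
  have limp: "((\<lambda>s. p (l s)) \<longlongrightarrow> p b) at_top"
    by (rule isCont_tendsto_compose[OF contp liml])
  have limf: "((\<lambda>s. f (\<Phi> (l s))) \<longlongrightarrow> p b) at_top"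
    using limp by (rule Lim_transform_eventually)
      (use eventually_ge_at_top[of 0] in eventually_elim, use lin \<Phi>(2) in auto)
  have cont\<gamma>: "continuous_on {0..} (\<lambda>s. \<Phi> (l s))"
    by (rule continuous_on_compose2[OF holomorphic_on_imp_continuous_on[OF \<Phi>(1)] contl])
      (use lin in auto)
  have "\<not> filterlim (\<lambda>s. \<Phi> (l s)) at_infinity at_top"
  proof
    assume "filterlim (\<lambda>s. \<Phi> (l s)) at_infinity at_top"
    with cont\<gamma> limf have "p b \<in> asymptotic_values f"
      unfolding asymptotic_values_def by blast
    with sv S(3)[OF bS] show False unfolding singular_values_within_def by force
  qed
  then obtain B where B: "\<not> (\<forall>\<^sub>F s in at_top. B \<le> norm (\<Phi> (l s)))"
    by (auto simp: filterlim_at_infinity[of 0])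
  then have fr: "\<exists>s\<ge>max 0 N. norm (\<Phi> (l s)) < B" for N
    unfolding eventually_at_top_linorder by (metis linorder_not_le)
  have "\<forall>n::nat. \<exists>s. s \<ge> max 0 (real n) \<and> norm (\<Phi> (l s)) < B"
    using fr by blast
  then obtain \<sigma> where \<sigma>: "\<And>n::nat. \<sigma> n \<ge> max 0 (real n)" "\<And>n. norm (\<Phi> (l (\<sigma> n))) < B"
    by metis
  obtain z k where k: "strict_mono k" and z: "((\<lambda>n. \<Phi> (l (\<sigma> n))) \<circ> k) \<longlonglongrightarrow> z"
    using compact_cball[of "0::complex" B, unfolded compact_def, rule_format, of "\<lambda>n. \<Phi> (l (\<sigma> n))"]
      \<sigma>(2) by (auto simp: less_imp_le)
  have \<sigma>top: "filterlim (\<lambda>n. \<sigma> (k n)) at_top sequentially"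
  proof (rule filterlim_at_top_mono[OF filterlim_real_sequentially], rule always_eventually, rule allI)
    fix n show "real n \<le> \<sigma> (k n)"
      using \<sigma>(1)[of "k n"] seq_suble[OF k, of n] by linarith
  qed
  have contf: "isCont f x" for x
    using hol holomorphic_on_imp_continuous_on continuous_on_eq_continuous_at by blast
  have fz: "f z = p b"
  proof (rule LIMSEQ_unique)
    show "(\<lambda>n. f (\<Phi> (l (\<sigma> (k n))))) \<longlonglongrightarrow> f z"
      using isCont_tendsto_compose[OF contf z] by (simp add: o_def)
    show "(\<lambda>n. f (\<Phi> (l (\<sigma> (k n))))) \<longlonglongrightarrow> p b"
      by (rule filterlim_compose[OF limf \<sigma>top])
  qed
  then have "deriv f z \<noteq> 0"
    using deriv_nonzero_of_large[OF sv] S(3)[OF bS] by metis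
  from local_inverse_branch[OF hol this] obtain r e g where re: "r > 0" "e > 0"
    and inj: "inj_on f (ball z r)" and g: "g holomorphic_on ball (f z) e"
    and gr: "\<And>w. w \<in> ball (f z) e \<Longrightarrow> g w \<in> ball z r \<and> f (g w) = w" by metis
  obtain d0 where d0: "d0 > 0" "ball b d0 \<subseteq> S" using S(1) bS open_contains_ball by blast
  obtain d1 where d1: "d1 > 0" "\<And>x. dist x b < d1 \<Longrightarrow> dist (p x) (p b) < e"
    using contp re(2) unfolding continuous_at_eps_delta by blast
  define d where "d = min d0 d1"
  have d: "d > 0" "ball b d \<subseteq> S" "\<And>x. x \<in> ball b d \<Longrightarrow> p x \<in> ball (f z) e"
    using d0 d1 by (auto simp: d_def fz dist_commute)
  define \<Psi> where "\<Psi> = (\<lambda>x. g (p x))"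
  have \<Psi>h: "\<Psi> holomorphic_on ball b d"
    unfolding \<Psi>_def
    by (rule holomorphic_on_compose_gen[OF holomorphic_on_subset[OF S(2) d(2)] g, unfolded o_def])
      (use d in auto)
  have \<Psi>f: "f (\<Psi> x) = p x" if "x \<in> ball b d" for x
    using gr d(3)[OF that] by (simp add: \<Psi>_def)
  have "(\<lambda>n. l (\<sigma> (k n))) \<longlonglongrightarrow> b" by (rule filterlim_compose[OF liml \<sigma>top])
  then have "\<forall>\<^sub>F n in sequentially. l (\<sigma> (k n)) \<in> ball b d"
    using d(1) tendstoD[of _ b sequentially d] by (simp add: dist_commute)
  moreover have "\<forall>\<^sub>F n in sequentially. \<Phi> (l (\<sigma> (k n))) \<in> ball z r"
    using tendstoD[OF z re(1)] by (simp add: dist_commute)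
  ultimately have "\<forall>\<^sub>F n in sequentially. l (\<sigma> (k n)) \<in> ball b d \<and> \<Phi> (l (\<sigma> (k n))) \<in> ball z r"
    by (rule eventually_conj)
  then obtain n where n: "l (\<sigma> (k n)) \<in> ball b d" "\<Phi> (l (\<sigma> (k n))) \<in> ball z r"
    by (auto simp: eventually_sequentially)
  define a where "a = l (\<sigma> (k n))"
  have a: "a \<in> ball b d \<inter> ball c t"
    using n lin \<sigma>(1)[of "k n"] unfolding a_def by simp
  have "\<Psi> a = \<Phi> a"
  proof (rule inj_onD[OF inj])
    show "f (\<Psi> a) = f (\<Phi> a)" using a \<Psi>f \<Phi>(2) by auto
    show "\<Psi> a \<in> ball z r" using gr d(3) a by (auto simp: \<Psi>_def)
    show "\<Phi> a \<in> ball z r" using n by (simp add: a_def)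
  qed
  have "\<Psi> x = \<Phi> x" if "x \<in> ball b d \<inter> ball c t" for x
  proof (rule lift_unique[OF hol, of "ball b d \<inter> ball c t" \<Psi> \<Phi>])
    show "connected (ball b d \<inter> ball c t)"
      by (intro convex_connected convex_Int convex_ball)
    show "continuous_on (ball b d \<inter> ball c t) \<Psi>" "continuous_on (ball b d \<inter> ball c t) \<Phi>"
      using \<Psi>h \<Phi>(1) holomorphic_on_imp_continuous_on continuous_on_subset by blast+
    show "deriv f (\<Psi> x) \<noteq> 0" if "x \<in> ball b d \<inter> ball c t" for x
      using deriv_nonzero_of_large[OF sv, of "\<Psi> x"] \<Psi>f S(3) d(2) that by auto
  qed (use a that \<Psi>f \<Phi>(2) \<open>\<Psi> a = \<Phi> a\<close> in auto)
  then show ?thesis using d \<Psi>h \<Psi>f by blast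
qed

lemma holomorphic_glue:
  fixes U :: "'i \<Rightarrow> complex set" and h :: "'i \<Rightarrow> complex \<Rightarrow> complex"
  assumes "\<And>i. i \<in> I \<Longrightarrow> open (U i)" "\<And>i. i \<in> I \<Longrightarrow> h i holomorphic_on U i"
    and agree: "\<And>i j x. i \<in> I \<Longrightarrow> j \<in> I \<Longrightarrow> x \<in> U i \<Longrightarrow> x \<in> U j \<Longrightarrow> h i x = h j x"
  obtains H where "H holomorphic_on (\<Union>i\<in>I. U i)" "\<And>i x. i \<in> I \<Longrightarrow> x \<in> U i \<Longrightarrow> H x = h i x"
proof -
  define H where "H = (\<lambda>x. h (SOME i. i \<in> I \<and> x \<in> U i) x)"
  have H: "H x = h i x" if "i \<in> I" "x \<in> U i" for i x
  proof -
    have "(SOME i. i \<in> I \<and> x \<in> U i) \<in> I \<and> x \<in> U (SOME i. i \<in> I \<and> x \<in> U i)"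
      by (rule someI[of "\<lambda>i. i \<in> I \<and> x \<in> U i" i]) (use that in blast)
    then show ?thesis unfolding H_def using agree that by blast
  qed
  have "H holomorphic_on U i" if "i \<in> I" for i
    using holomorphic_transform[OF assms(2)[OF that], of H] H[OF that] by simp
  then have "H holomorphic_on (\<Union>i\<in>I. U i)"
    by (intro holomorphic_on_UN_open assms(1)) auto
  with H that show ?thesis by blast
qed

text \<open>
  The continuations at the boundary points fit together: two discs centred on the bounding circle
  that meet also meet inside the ball, where both continuations equal the given lift, and they agree on the convex
  intersection by uniqueness. The glued function is defined on an open set containing the closed ball,
  hence on a larger ball.
\<close>
lemma lift_extend:
  fixes f p \<Phi> :: "complex \<Rightarrow> complex" and c :: complex
  assumes hol: "f holomorphic_on UNIV" and sv: "singular_values_within f R"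
    and S: "open S" "p holomorphic_on S" "\<And>x. x \<in> S \<Longrightarrow> cmod (p x) > R"
    and t: "t > 0" "cball c t \<subseteq> S"
    and \<Phi>: "\<Phi> holomorphic_on ball c t" "\<And>x. x \<in> ball c t \<Longrightarrow> f (\<Phi> x) = p x"
  obtains u \<Psi> where "u > t" "\<Psi> holomorphic_on ball c u" "\<And>x. x \<in> ball c u \<Longrightarrow> f (\<Psi> x) = p x"
    "\<Psi> c = \<Phi> c"
proof -
  have "\<forall>b. \<exists>d \<Psi>. dist c b = t \<longrightarrow> d > 0 \<and> ball b d \<subseteq> S \<and> \<Psi> holomorphic_on ball b d \<and>
      (\<forall>x \<in> ball b d. f (\<Psi> x) = p x) \<and> (\<forall>x \<in> ball b d \<inter> ball c t. \<Psi> x = \<Phi> x)"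
    using lift_boundary_point[OF hol sv S t \<Phi>] by blast
  then obtain d \<Psi> where "\<forall>b. dist c b = t \<longrightarrow> d b > 0 \<and> ball b (d b) \<subseteq> S \<and>
      \<Psi> b holomorphic_on ball b (d b) \<and>
      (\<forall>x \<in> ball b (d b). f (\<Psi> b x) = p x) \<and> (\<forall>x \<in> ball b (d b) \<inter> ball c t. \<Psi> b x = \<Phi> x)"
    unfolding choice_iff by blast
  then have d: "\<And>b. dist c b = t \<Longrightarrow> d b > 0" "\<And>b. dist c b = t \<Longrightarrow> ball b (d b) \<subseteq> S"
    and \<Psi>: "\<And>b. dist c b = t \<Longrightarrow> \<Psi> b holomorphic_on ball b (d b)"
      "\<And>b x. dist c b = t \<Longrightarrow> x \<in> ball b (d b) \<Longrightarrow> f (\<Psi> b x) = p x"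
      "\<And>b x. dist c b = t \<Longrightarrow> x \<in> ball b (d b) \<Longrightarrow> x \<in> ball c t \<Longrightarrow> \<Psi> b x = \<Phi> x"
    by blast+
  have agree: "\<Psi> a x = \<Psi> b x" if ab: "dist c a = t" "dist c b = t"
    and x: "x \<in> ball a (d a)" "x \<in> ball b (d b)" for a b x
  proof (cases "a = b")
    case False
    \<comment> \<open>The point dividing the segment between the centres in the ratio of the radii lies in both discs,
      and by strict convexity also in the open ball.\<close>
    define q where "q = d a / (d a + d b)"
    define m where "m = a + of_real q * (b - a)"
    have q: "0 < q" "q < 1" using d(1) ab by (auto simp: q_def divide_simps add_pos_pos)
    have dab: "dist a b < d a + d b"
      using x dist_triangle2[of a b x] by (simp add: dist_commute)
    have "dist a m = q * dist a b"
      using q by (simp add: m_def dist_norm norm_mult norm_minus_commute)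
    also have "\<dots> < q * (d a + d b)" using q dab by simp
    also have "\<dots> = d a" using d(1)[OF ab(1)] d(1)[OF ab(2)] by (simp add: q_def)
    finally have ma: "m \<in> ball a (d a)" by simp
    have "b - m = of_real (1 - q) * (b - a)" by (simp add: m_def algebra_simps)
    then have "dist b m = (1 - q) * dist a b"
      using q by (simp only: dist_norm norm_mult norm_of_real) (simp add: norm_minus_commute)
    also have "\<dots> < (1 - q) * (d a + d b)" using q dab by simp
    also have "\<dots> = d b" using d(1)[OF ab(1)] d(1)[OF ab(2)] by (simp add: q_def field_simps)
    finally have mb: "m \<in> ball b (d b)" by simp
    have "m \<in> open_segment a b"
      unfolding in_segment using q False
      by (auto intro!: exI[of _ q] simp: m_def scaleR_conv_of_real algebra_simps)
    then have "m \<in> ball c t"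
      using dist_decreases_open_segment[of m a b c] ab by (auto simp: dist_commute)
    then have eqm: "\<Psi> a m = \<Psi> b m" using \<Psi>(3) ab ma mb by metis
    show ?thesis
    proof (rule lift_unique[OF hol, of "ball a (d a) \<inter> ball b (d b)" "\<Psi> a" "\<Psi> b"])
      show "connected (ball a (d a) \<inter> ball b (d b))"
        by (intro convex_connected convex_Int convex_ball)
      show "continuous_on (ball a (d a) \<inter> ball b (d b)) (\<Psi> a)"
        "continuous_on (ball a (d a) \<inter> ball b (d b)) (\<Psi> b)"
        using continuous_on_subset[OF holomorphic_on_imp_continuous_on[OF \<Psi>(1)[OF ab(1)]]]
          continuous_on_subset[OF holomorphic_on_imp_continuous_on[OF \<Psi>(1)[OF ab(2)]]] by auto
      show "deriv f (\<Psi> a y) \<noteq> 0" if "y \<in> ball a (d a) \<inter> ball b (d b)" for y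
        using deriv_nonzero_of_large[OF sv, of "\<Psi> a y"] \<Psi>(2)[OF ab(1), of y] S(3)[of y]
          d(2)[OF ab(1)] that by auto
    qed (use x ma mb eqm \<Psi>(2) ab in auto)
  qed simp
  \<comment> \<open>The centre serves as the index of the original ball, the boundary points as indices of the new discs.\<close>
  define U where "U = (\<lambda>b. if b = c then ball c t else ball b (d b))"
  define h where "h = (\<lambda>b. if b = c then \<Phi> else \<Psi> b)"
  define J where "J = insert c (sphere c t)"
  have I: "i = c \<or> dist c i = t \<and> i \<noteq> c" if "i \<in> J" for i
    using that t by (auto simp: J_def)
  have C: "h i x = \<Phi> x" if "i \<in> J" "x \<in> U i" "x \<in> ball c t" for i x
  proof (cases "i = c")
    case False
    then have "dist c i = t" using I that(1) by blast
    then show ?thesis using \<Psi>(3)[of i x] that(2,3) False by (simp add: U_def h_def)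
  qed (simp add: h_def)
  obtain H where H: "H holomorphic_on (\<Union>i\<in>J. U i)"
    "\<And>i x. i \<in> J \<Longrightarrow> x \<in> U i \<Longrightarrow> H x = h i x"
  proof (rule holomorphic_glue[of "J" U h])
    show "open (U i)" for i by (simp add: U_def)
    show "h i holomorphic_on U i" if "i \<in> J" for i
    proof (cases "i = c")
      case False
      then have "dist c i = t" using I that by blast
      then show ?thesis using \<Psi>(1)[of i] False by (simp add: U_def h_def)
    qed (simp add: U_def h_def \<Phi>(1))
    show "h i x = h j x" if "i \<in> J" "j \<in> J"
      "x \<in> U i" "x \<in> U j" for i j x
    proof (cases "i = c \<or> j = c")
      case True
      then have "x \<in> ball c t" using that(3,4) by (auto simp: U_def)
      then show ?thesis using C that by metis
    next
      case False
      then have "dist c i = t" "dist c j = t" using I that(1,2) by blast+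
      then show ?thesis using agree[of i j x] that(3,4) False by (simp add: U_def h_def)
    qed
  qed (use that in blast)
  define V where "V = (\<Union>i\<in>J. U i)"
  have opV: "open V" by (auto simp: V_def U_def)
  have "cball c t \<subseteq> V"
  proof
    fix x assume "x \<in> cball c t"
    then consider "x \<in> ball c t" | "dist c x = t" by force
    then show "x \<in> V"
    proof cases
      case 1 then show ?thesis by (auto simp: V_def U_def J_def)
    next
      case 2 then have "x \<in> U x" using d(1) t by (auto simp: U_def)
      with 2 show ?thesis by (auto simp: V_def J_def)
    qed
  qed
  then obtain e where e: "e > 0" "(\<Union>x\<in>cball c t. cball x e) \<subseteq> V"
    using compact_subset_open_imp_cball_epsilon_subset[OF compact_cball opV] by metis
  have sub: "ball c (t + e) \<subseteq> V"
  proof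
    fix x assume x: "x \<in> ball c (t + e)"
    show "x \<in> V"
    proof (cases "dist c x \<le> t")
      case True
      then show ?thesis using \<open>cball c t \<subseteq> V\<close> by auto
    next
      case False
      define y where "y = c + of_real (t / dist c x) * (x - c)"
      have "x \<noteq> c" using False t by auto
      then have "dist c y = t" using False t
        unfolding y_def dist_norm by (simp del: of_real_divide add: norm_mult norm_minus_commute[of c])
      have "x - y = of_real (1 - t / dist c x) * (x - c)"
        by (simp add: y_def algebra_simps)
      then have "dist y x = \<bar>1 - t / dist c x\<bar> * dist c x"
        unfolding dist_norm by (simp only: norm_mult norm_of_real norm_minus_commute[of y] norm_minus_commute[of c])
      moreover have "t / dist c x < 1" using False t by (simp add: divide_less_eq)
      ultimately have "dist y x = (1 - t / dist c x) * dist c x" by simp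
      then have "dist y x = dist c x - t" using \<open>x \<noteq> c\<close> by (simp add: left_diff_distrib)
      then have "x \<in> cball y e" using x by simp
      then show ?thesis using e(2) \<open>dist c y = t\<close> by (metis UN_I mem_cball order_refl subsetD)
    qed
  qed
  show ?thesis
  proof (rule that[of "t + e" H])
    show "H holomorphic_on ball c (t + e)" using H(1) sub V_def holomorphic_on_subset by blast
    show "f (H x) = p x" if "x \<in> ball c (t + e)" for x
    proof -
      have "x \<in> V" using that sub by blast
      then obtain i where i: "i \<in> J" "x \<in> U i" unfolding V_def by blast
      show ?thesis
      proof (cases "i = c")
        case True
        then show ?thesis using H(2)[OF i] i(2) \<Phi>(2)[of x] by (simp add: U_def h_def)
      next
        case False
        then have "dist c i = t" using I i(1) by blast
        then show ?thesis using H(2)[OF i] i(2) \<Psi>(2)[of i x] False by (simp add: U_def h_def)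
      qed
    qed
    show "H c = \<Phi> c" using H(2)[of c c] t by (simp add: U_def h_def J_def)
  qed (use e in simp)
qed

text \<open>
  The lift on the ball of maximal radius exists as the union of the smaller lifts, and
  \<open>lift_extend\<close> shows that this radius cannot be less than \<open>r\<close>.
\<close>
lemma lift_ball:
  fixes f p :: "complex \<Rightarrow> complex" and c :: complex
  assumes hol: "f holomorphic_on UNIV" and sv: "singular_values_within f R"
    and r: "r > 0" and p: "p holomorphic_on ball c r" "\<And>x. x \<in> ball c r \<Longrightarrow> cmod (p x) > R"
    and z: "f z = p c"
  obtains \<Phi> where "\<Phi> holomorphic_on ball c r" "\<And>x. x \<in> ball c r \<Longrightarrow> f (\<Phi> x) = p x" "\<Phi> c = z"
proof -
  define lift where "lift = (\<lambda>t \<Phi>. \<Phi> holomorphic_on ball c t \<and>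
     (\<forall>x \<in> ball c t. f (\<Phi> x) = p x) \<and> \<Phi> c = z)"
  define T where "T = {t. 0 < t \<and> t \<le> r \<and> (\<exists>\<Phi>. lift t \<Phi>)}"
  have "T \<noteq> {}"
  proof -
    have "deriv f z \<noteq> 0"
      using deriv_nonzero_of_large[OF sv] z p(2)[of c] r by simp
    from local_inverse_branch[OF hol this] obtain s e g where se: "s > 0" "e > 0"
      and inj: "inj_on f (ball z s)" and g: "g holomorphic_on ball (f z) e"
      and gs: "\<And>w. w \<in> ball (f z) e \<Longrightarrow> g w \<in> ball z s \<and> f (g w) = w" by metis
    have "isCont p c"
      using p(1) r holomorphic_on_imp_continuous_on continuous_on_eq_continuous_at
      by (metis centre_in_ball open_ball)
    then obtain d where d: "d > 0" "\<And>x. dist x c < d \<Longrightarrow> dist (p x) (p c) < e"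
      using se(2) unfolding continuous_at_eps_delta by blast
    define t where "t = min d r"
    have t: "0 < t" "t \<le> r" using d r by (auto simp: t_def)
    have pe: "p x \<in> ball (f z) e" if "x \<in> ball c t" for x
      using d(2)[of x] that by (simp add: z dist_commute t_def)
    have "(\<lambda>x. g (p x)) holomorphic_on ball c t"
      by (rule holomorphic_on_compose_gen[OF holomorphic_on_subset[OF p(1)] g, unfolded o_def])
        (use t pe in auto)
    moreover have "\<forall>x\<in>ball c t. f (g (p x)) = p x" using gs pe by blast
    moreover have "g (p c) = z"
      using inj gs[of "f z"] se z unfolding inj_on_def by (metis centre_in_ball)
    ultimately have "lift t (\<lambda>x. g (p x))" by (simp add: lift_def)
    then show ?thesis using t by (auto simp: T_def)
  qed
  have bdd: "bdd_above T" by (auto simp: T_def intro!: bdd_aboveI[of _ r])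
  define s where "s = Sup T"
  have s: "0 < s" "s \<le> r"
  proof -
    obtain t where "t \<in> T" using \<open>T \<noteq> {}\<close> by blast
    then show "0 < s" using cSup_upper[OF _ bdd] by (force simp: s_def T_def)
    show "s \<le> r" unfolding s_def by (rule cSup_least[OF \<open>T \<noteq> {}\<close>]) (auto simp: T_def)
  qed
  have "\<forall>t. \<exists>\<Phi>. t \<in> T \<longrightarrow> lift t \<Phi>" by (auto simp: T_def)
  then obtain \<Phi> where \<Phi>: "\<And>t. t \<in> T \<Longrightarrow> lift t (\<Phi> t)" by metis
  have agree: "\<Phi> t x = \<Phi> u x" if "t \<in> T" "u \<in> T" "t \<le> u" "x \<in> ball c t" for t u x
  proof (rule lift_unique[OF hol, of "ball c t" "\<Phi> t" "\<Phi> u"])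
    have sub: "ball c t \<subseteq> ball c u" using that by auto
    have tr: "ball c t \<subseteq> ball c r" "0 < t" using that by (auto simp: T_def)
    show "connected (ball c t)" by simp
    show "continuous_on (ball c t) (\<Phi> t)" "continuous_on (ball c t) (\<Phi> u)"
      using \<Phi>[OF that(1)] \<Phi>[OF that(2)] sub holomorphic_on_imp_continuous_on continuous_on_subset
      unfolding lift_def by blast+
    show "f (\<Phi> t y) = f (\<Phi> u y)" if "y \<in> ball c t" for y
      using \<Phi>[OF \<open>t \<in> T\<close>] \<Phi>[OF \<open>u \<in> T\<close>] that sub by (auto simp: lift_def)
    show "deriv f (\<Phi> t y) \<noteq> 0" if "y \<in> ball c t" for y
      using deriv_nonzero_of_large[OF sv, of "\<Phi> t y"] \<Phi>[OF \<open>t \<in> T\<close>] p(2)[of y] that tr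
      by (auto simp: lift_def)
    show "c \<in> ball c t" using tr by simp
    show "\<Phi> t c = \<Phi> u c" using \<Phi>[OF that(1)] \<Phi>[OF that(2)] by (simp add: lift_def)
  qed (use that in auto)
  obtain H where H: "H holomorphic_on (\<Union>t\<in>T. ball c t)"
    "\<And>t x. t \<in> T \<Longrightarrow> x \<in> ball c t \<Longrightarrow> H x = \<Phi> t x"
  proof (rule holomorphic_glue[of T "ball c" \<Phi>])
    show "\<Phi> t holomorphic_on ball c t" if "t \<in> T" for t
      using \<Phi>[OF that] by (simp add: lift_def)
    show "\<Phi> t x = \<Phi> u x" if "t \<in> T" "u \<in> T" "x \<in> ball c t" "x \<in> ball c u" for t u x
      using agree that by (metis linear)
  qed (use that in auto)
  have un: "(\<Union>t\<in>T. ball c t) = ball c s"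
  proof (intro equalityI subsetI)
    fix x assume "x \<in> ball c s"
    then obtain t where "t \<in> T" "dist c x < t"
      using less_cSupD[OF \<open>T \<noteq> {}\<close>] unfolding s_def by auto
    then show "x \<in> (\<Union>t\<in>T. ball c t)" by auto
  next
    fix x assume "x \<in> (\<Union>t\<in>T. ball c t)"
    then obtain t where "t \<in> T" "dist c x < t" by auto
    then show "x \<in> ball c s" using cSup_upper[OF _ bdd] by (force simp: s_def)
  qed
  have Hf: "f (H x) = p x" if x: "x \<in> ball c s" for x
  proof -
    obtain t where "t \<in> T" "x \<in> ball c t" using x unfolding un[symmetric] by blast
    then show ?thesis using H(2) \<Phi> by (auto simp: lift_def)
  qed
  have Hc: "H c = z"
  proof -
    obtain t where t: "t \<in> T" using \<open>T \<noteq> {}\<close> by blast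
    then have "c \<in> ball c t" by (simp add: T_def)
    then show ?thesis using H(2)[OF t] \<Phi>[OF t] by (simp add: lift_def)
  qed
  have "s = r"
  proof (rule ccontr)
    assume "s \<noteq> r"
    then have "s < r" using s by simp
    then have "cball c s \<subseteq> ball c r" by auto
    obtain u \<Psi> where u: "u > s" "\<Psi> holomorphic_on ball c u"
      "\<And>x. x \<in> ball c u \<Longrightarrow> f (\<Psi> x) = p x" "\<Psi> c = H c"
      using lift_extend[OF hol sv open_ball p s(1) \<open>cball c s \<subseteq> ball c r\<close> H(1)[unfolded un] Hf]
      by metis
    have "lift (min u r) \<Psi>"
      unfolding lift_def using u Hc
      by (auto intro: holomorphic_on_subset[OF u(2)])
    then have "min u r \<in> T" using u s r by (auto simp: T_def)
    then have "min u r \<le> s" unfolding s_def by (rule cSup_upper[OF _ bdd])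
    with u \<open>s < r\<close> show False by simp
  qed
  then show ?thesis using that H(1) un Hf Hc by metis
qed

section \<open>The expansion estimate of Eremenko and Lyubich\<close>

text \<open>
  A Cayley transform taking the unit disc to the half plane and \<open>0\<close> to \<open>b\<close> reduces this to the
  lifting of a map defined on a disc.
\<close>
lemma logarithmic_lift:
  fixes f :: "complex \<Rightarrow> complex"
  assumes hol: "f holomorphic_on UNIV" and sv: "singular_values_within f R" and R: "R > 0"
    and b: "ln R < Re b" and z: "f z = exp b"
  obtains \<Phi> where "\<Phi> holomorphic_on {w. ln R < Re w}" "\<And>w. ln R < Re w \<Longrightarrow> f (\<Phi> w) = exp w"
    "\<Phi> b = z"
proof -
  define d where "d = Re b - ln R"
  have d: "d > 0" using b by (simp add: d_def)
  define \<kappa> where "\<kappa> = (\<lambda>u::complex. b + 2 * of_real d * u / (1 - u))"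
  have ne: "1 - u \<noteq> 0" if "u \<in> ball 0 1" for u :: complex using that by auto
  have re: "ln R < Re (\<kappa> u)" if u: "u \<in> ball 0 1" for u
  proof -
    have "\<kappa> u = (b - of_real d) + of_real d * ((1 + u) / (1 - u))"
      using ne[OF u] by (simp add: \<kappa>_def field_simps)
    then have "Re (\<kappa> u) = Re b - d + d * Re ((1 + u) / (1 - u))"
      by (simp only: plus_complex.sel minus_complex.sel times_complex.sel Re_complex_of_real
          Im_complex_of_real mult_zero_left diff_zero)
    then have "Re (\<kappa> u) = ln R + d * Re ((1 + u) / (1 - u))" by (simp only: d_def)
    moreover have "Re ((1 + u) / (1 - u)) > 0"
    proof -
      have n1: "(cmod u)\<^sup>2 < 1" using u by (simp add: power_less_one_iff)
      have "Re ((1 + u) / (1 - u)) = (1 - (cmod u)\<^sup>2) / (cmod (1 - u))\<^sup>2"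
        by (simp add: Re_divide cmod_power2) (simp add: power2_eq_square algebra_simps)
      then show ?thesis using n1 ne[OF u] by simp
    qed
    ultimately show ?thesis using d by simp
  qed
  have \<kappa>h: "\<kappa> holomorphic_on ball 0 1"
    unfolding \<kappa>_def by (intro holomorphic_intros) (use ne in auto)
  obtain \<Theta> where \<Theta>: "\<Theta> holomorphic_on ball 0 1" "\<And>u. u \<in> ball 0 1 \<Longrightarrow> f (\<Theta> u) = exp (\<kappa> u)"
    "\<Theta> 0 = z"
  proof (rule lift_ball[OF hol sv, of 1 "\<lambda>u. exp (\<kappa> u)" 0 z])
    show "(\<lambda>u. exp (\<kappa> u)) holomorphic_on ball 0 1"
      using \<kappa>h by (intro holomorphic_intros)
    show "cmod (exp (\<kappa> u)) > R" if "u \<in> ball 0 1" for u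
      using re[OF that] R by (metis exp_less_cancel_iff exp_ln norm_exp_eq_Re)
    show "f z = exp (\<kappa> 0)" using z by (simp add: \<kappa>_def)
  qed (use that in auto)
  define \<mu> where "\<mu> = (\<lambda>w. (w - b) / (w - b + 2 * of_real d))"
  have ne2: "w - b + 2 * of_real d \<noteq> 0" if "ln R < Re w" for w
  proof -
    have "Re (w - b + 2 * of_real d) > 0" using that d by (simp add: d_def)
    then show ?thesis by force
  qed
  have \<mu>b: "\<mu> w \<in> ball 0 1" if "ln R < Re w" for w
  proof -
    have "(cmod (w - b))\<^sup>2 < (cmod (w - b + 2 * of_real d))\<^sup>2"
    proof -
      have "(cmod (w - b + 2 * of_real d))\<^sup>2 = (cmod (w - b))\<^sup>2 + 4 * d * (Re w - ln R)"
        by (simp only: cmod_power2) (simp add: d_def power2_eq_square algebra_simps)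
      moreover have "4 * d * (Re w - ln R) > 0" using d that by simp
      ultimately show ?thesis by simp
    qed
    then have "cmod (w - b) < cmod (w - b + 2 * of_real d)"
      by (rule power2_less_imp_less) simp
    then show ?thesis using ne2[OF that] by (simp add: \<mu>_def norm_divide divide_less_eq)
  qed
  have \<kappa>\<mu>: "\<kappa> (\<mu> w) = w" if "ln R < Re w" for w
  proof -
    have dd: "(of_real d :: complex) \<noteq> 0" using d by simp
    have "1 - \<mu> w = 2 * of_real d / (w - b + 2 * of_real d)"
      using ne2[OF that] by (simp add: \<mu>_def field_simps)
    then show ?thesis
      using ne2[OF that] dd by (simp add: \<kappa>_def \<mu>_def)
  qed
  show ?thesis
  proof (rule that[of "\<lambda>w. \<Theta> (\<mu> w)"])
    have "\<mu> holomorphic_on {w. ln R < Re w}"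
      unfolding \<mu>_def by (intro holomorphic_intros) (use ne2 in auto)
    then show "(\<lambda>w. \<Theta> (\<mu> w)) holomorphic_on {w. ln R < Re w}"
      by (rule holomorphic_on_compose_gen[OF _ \<Theta>(1), unfolded o_def]) (use \<mu>b in blast)
    show "f (\<Theta> (\<mu> w)) = exp w" if "ln R < Re w" for w
      using \<Theta>(2)[OF \<mu>b[OF that]] \<kappa>\<mu>[OF that] by simp
    show "\<Theta> (\<mu> b) = z" by (simp add: \<mu>_def \<Theta>(3))
  qed
qed

lemma transcendental_not_tendsto_infinity:
  assumes "transcendental_entire f"
  shows "\<not> filterlim f at_infinity at_infinity"
proof
  assume "filterlim f at_infinity at_infinity"
  then have "((inverse \<circ> f) \<longlongrightarrow> 0) at_infinity"
    unfolding o_def by (rule filterlim_compose[OF tendsto_inverse_0])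
  moreover have "f holomorphic_on UNIV" using assms by (simp add: transcendental_entire_def)
  ultimately obtain a n where "\<And>z. f z = (\<Sum>i\<le>n. a i * z ^ i)"
    using pole_at_infinity by metis
  then have "\<forall>z. f z = poly (\<Sum>i\<le>n. monom (a i) i) z" by (simp add: poly_sum poly_monom)
  then show False using assms unfolding transcendental_entire_def by blast
qed

text \<open>
  A periodic lift would be a function of \<open>exp (w / k)\<close>, so the component of
  \<open>{z. cmod (f z) > exp a}\<close> that contains its values would be a punctured neighbourhood of infinity on which
  \<open>f\<close> behaves like a power. The argument avoids this factorisation. For \<open>x > a\<close> the image \<open>T\<close>
  of the half plane \<open>x < Re w\<close> is open and unbounded. By periodicity its boundary lies in the image of a
  segment of the line \<open>Re w = x\<close>, which is compact. The outside of a large disc is connected, so it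
  lies in \<open>T\<close>, where \<open>f\<close> has modulus greater than \<open>exp x\<close>. As \<open>x\<close> is
  arbitrary, \<open>f\<close> tends to infinity at infinity.
\<close>
lemma logarithmic_lift_not_periodic:
  fixes f \<Phi> :: "complex \<Rightarrow> complex" and \<tau> :: real
  assumes tr: "transcendental_entire f"
    and \<Phi>: "\<Phi> holomorphic_on {w. a < Re w}" "\<And>w. a < Re w \<Longrightarrow> f (\<Phi> w) = exp w"
    and \<tau>: "\<tau> \<noteq> 0" and per: "\<And>w. a < Re w \<Longrightarrow> \<Phi> (w + \<i> * of_real \<tau>) = \<Phi> w"
  shows False
proof -
  have hol: "f holomorphic_on UNIV" using tr by (simp add: transcendental_entire_def)
  have contf: "continuous_on S f" for S
    using holomorphic_on_imp_continuous_on[OF hol] continuous_on_subset by blast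
  have bound: "\<exists>y. \<forall>z \<in> cball c r. cmod (f z) \<le> exp y" for c r
  proof -
    have "compact (f ` cball c r)" by (intro compact_continuous_image contf) simp
    then obtain B where "B > 0" "\<forall>z \<in> cball c r. cmod (f z) \<le> B"
      using compact_imp_bounded bounded_pos by (metis imageI)
    then show ?thesis by (intro exI[of _ "ln B"]) simp
  qed
  have cont\<Phi>: "continuous_on S \<Phi>" if "S \<subseteq> {w. a < Re w}" for S
    using holomorphic_on_imp_continuous_on[OF \<Phi>(1)] that continuous_on_subset by blast
  have norm\<Phi>: "cmod (f (\<Phi> w)) = exp (Re w)" if "a < Re w" for w
    using \<Phi>(2)[OF that] by simp
  have pern: "\<Phi> (w + \<i> * of_real (real n * \<bar>\<tau>\<bar>)) = \<Phi> w" if "a < Re w" for w n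
  proof -
    have 1: "\<Phi> (w + \<i> * of_real \<bar>\<tau>\<bar>) = \<Phi> w" if "a < Re w" for w
    proof (cases "\<tau> > 0")
      case False
      have "\<Phi> (w + \<i> * of_real \<bar>\<tau>\<bar> + \<i> * of_real \<tau>) = \<Phi> (w + \<i> * of_real \<bar>\<tau>\<bar>)"
        using per[of "w + \<i> * of_real \<bar>\<tau>\<bar>"] that by simp
      then show ?thesis using False by simp
    qed (use per that in simp)
    show ?thesis using that
    proof (induction n)
      case (Suc n)
      have "w + \<i> * of_real (real (Suc n) * \<bar>\<tau>\<bar>) = (w + \<i> * of_real (real n * \<bar>\<tau>\<bar>)) + \<i> * of_real \<bar>\<tau>\<bar>"
        by (simp add: algebra_simps)
      then have "\<Phi> (w + \<i> * of_real (real (Suc n) * \<bar>\<tau>\<bar>)) = \<Phi> (w + \<i> * of_real (real n * \<bar>\<tau>\<bar>))"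
        using 1[of "w + \<i> * of_real (real n * \<bar>\<tau>\<bar>)"] Suc.prems by (metis Re_i_times Im_complex_of_real add.right_neutral neg_0_equal_iff_equal plus_complex.sel(1))
      then show ?case using Suc by simp
    qed simp
  qed
  \<comment> \<open>One period strip suffices, which makes the relevant pieces of the half plane compact.\<close>
  have reduce: "\<exists>v. Re v = Re w \<and> 0 \<le> Im v \<and> Im v \<le> \<bar>\<tau>\<bar> \<and> \<Phi> v = \<Phi> w" if w: "a < Re w" for w
  proof -
    define m where "m = \<lfloor>Im w / \<bar>\<tau>\<bar>\<rfloor>"
    define v where "v = w - \<i> * of_real (of_int m * \<bar>\<tau>\<bar>)"
    have m: "of_int m \<le> Im w / \<bar>\<tau>\<bar>" "Im w / \<bar>\<tau>\<bar> \<le> of_int m + 1"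
      unfolding m_def by linarith+
    then have "of_int m * \<bar>\<tau>\<bar> \<le> Im w" "Im w \<le> (of_int m + 1) * \<bar>\<tau>\<bar>"
      using \<tau> by (simp_all add: le_divide_eq divide_le_eq)
    then have "0 \<le> Im v" "Im v \<le> \<bar>\<tau>\<bar>" by (auto simp: v_def algebra_simps)
    moreover have "\<Phi> v = \<Phi> w"
    proof (cases "m \<ge> 0")
      case True
      then have "w = v + \<i> * of_real (real (nat m) * \<bar>\<tau>\<bar>)" by (simp add: v_def)
      moreover have "\<Phi> (v + \<i> * of_real (real (nat m) * \<bar>\<tau>\<bar>)) = \<Phi> v"
        by (rule pern) (use w in \<open>simp add: v_def\<close>)
      ultimately show ?thesis by metis
    next
      case False
      then have "v = w + \<i> * of_real (real (nat (- m)) * \<bar>\<tau>\<bar>)" by (simp add: v_def)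
      then show ?thesis using pern[OF w, of "nat (- m)"] by metis
    qed
    ultimately show ?thesis by (intro exI[of _ v]) (simp add: v_def)
  qed
  have strip: "compact (\<Phi> ` {w. x \<le> Re w \<and> Re w \<le> y \<and> 0 \<le> Im w \<and> Im w \<le> \<bar>\<tau>\<bar>})" if "a < x" for x y
  proof -
    have "{w. x \<le> Re w \<and> Re w \<le> y \<and> 0 \<le> Im w \<and> Im w \<le> \<bar>\<tau>\<bar>} = cbox (Complex x 0) (Complex y \<bar>\<tau>\<bar>)"
      by (auto simp: in_cbox_complex_iff)
    moreover have "cbox (Complex x 0) (Complex y \<bar>\<tau>\<bar>) \<subseteq> {w. a < Re w}"
      using that by (auto simp: in_cbox_complex_iff)
    ultimately show ?thesis by (simp add: compact_continuous_image cont\<Phi>)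
  qed
  have opH: "open {w. a < Re w}" "connected {w. a < Re w}"
    by (simp_all add: open_halfspace_Re_gt convex_connected convex_halfspace_Re_gt)
  have nonconst: "\<not> \<Phi> constant_on {w. a < Re w}"
  proof
    assume "\<Phi> constant_on {w. a < Re w}"
    then have "\<Phi> (of_real (a + 1)) = \<Phi> (of_real (a + 2))" by (auto simp: constant_on_def)
    then have "exp (a + 1) = exp (a + 2)"
      using norm\<Phi>[of "of_real (a + 1)"] norm\<Phi>[of "of_real (a + 2)"] by simp
    then show False by simp
  qed
  have "\<exists>M. \<forall>z. cmod z > M \<longrightarrow> cmod (f z) > exp x" if x: "a < x" for x
  proof -
    define T where "T = \<Phi> ` {w. x < Re w}"
    have opT: "open T"
      unfolding T_def
      by (rule open_mapping_thm[OF \<Phi>(1) opH _ _ nonconst]) (use x in \<open>auto simp: open_halfspace_Re_gt\<close>)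
    obtain M where M: "\<Phi> ` {w. x \<le> Re w \<and> Re w \<le> x \<and> 0 \<le> Im w \<and> Im w \<le> \<bar>\<tau>\<bar>} \<subseteq> ball 0 M"
      using bounded_subset_ballD[OF compact_imp_bounded[OF strip[OF x, of x]], of 0] by blast
    define A where "A = - cball (0::complex) M"
    have conA: "connected A"
      unfolding A_def by (rule connected_complement_bounded_convex) auto
    have opA: "open (A - T)"
      unfolding open_contains_ball
    proof
      fix z assume z: "z \<in> A - T"
      \<comment> \<open>Near \<open>z\<close> the modulus of \<open>f\<close> is bounded, so only a compact part of the period strip can
        be mapped there.\<close>
      obtain y where y: "\<And>u. u \<in> cball z 1 \<Longrightarrow> cmod (f u) \<le> exp y" using bound by blast
      define K where "K = \<Phi> ` {w. x \<le> Re w \<and> Re w \<le> y \<and> 0 \<le> Im w \<and> Im w \<le> \<bar>\<tau>\<bar>}"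
      have "z \<notin> K"
      proof
        assume "z \<in> K"
        then obtain w where w: "x \<le> Re w" "0 \<le> Im w" "Im w \<le> \<bar>\<tau>\<bar>" "z = \<Phi> w" by (auto simp: K_def)
        then have "Re w = x" using z by (force simp: T_def)
        then have "z \<in> ball 0 M" using M w by blast
        then show False using z by (simp add: A_def)
      qed
      moreover have "closed K" unfolding K_def by (intro compact_imp_closed strip x)
      ultimately have "open (A - K)" "z \<in> A - K" using z by (auto simp: A_def open_Diff)
      then obtain e where e: "e > 0" "ball z e \<subseteq> A - K" using open_contains_ball by blast
      have "ball z (min e 1) \<subseteq> A - T"
      proof
        fix u assume u: "u \<in> ball z (min e 1)"
        have "u \<notin> T"
        proof
          assume "u \<in> T"
          then obtain w where w: "x < Re w" "u = \<Phi> w" by (auto simp: T_def)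
          have "exp (Re w) \<le> exp y" using y[of u] u norm\<Phi>[of w] w x by simp
          then have "Re w \<le> y" by simp
          moreover obtain v where "Re v = Re w" "0 \<le> Im v" "Im v \<le> \<bar>\<tau>\<bar>" "\<Phi> v = \<Phi> w"
            using reduce[of w] w(1) x by auto
          ultimately have "u \<in> K" unfolding K_def w(2) using w(1) by (intro image_eqI[of _ _ v]) auto
          then show False using e u by auto
        qed
        then show "u \<in> A - T" using e u by auto
      qed
      then show "\<exists>e>0. ball z e \<subseteq> A - T" using e(1) by (intro exI[of _ "min e 1"]) auto
    qed
    have "T \<inter> A \<noteq> {}"
    proof -
      obtain y where y: "\<And>u. u \<in> cball 0 M \<Longrightarrow> cmod (f u) \<le> exp y" using bound by blast
      define w where "w = complex_of_real (max x y + 1)"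
      have w: "x < Re w" "a < Re w" "y < Re w" using x by (auto simp: w_def)
      have "\<Phi> w \<notin> cball 0 M"
      proof
        assume "\<Phi> w \<in> cball 0 M"
        then have "exp (Re w) \<le> exp y" using y norm\<Phi>[OF w(2)] by metis
        then show False using w(3) by simp
      qed
      then show ?thesis using w by (auto simp: T_def A_def)
    qed
    moreover have "T \<inter> A = {} \<or> (A - T) \<inter> A = {}"
      by (rule connectedD[OF conA opT opA]) auto
    ultimately have AT: "A \<subseteq> T" by blast
    have "cmod (f z) > exp x" if "cmod z > M" for z
    proof -
      have "z \<in> T" using AT that by (auto simp: A_def)
      then show ?thesis using norm\<Phi> x by (auto simp: T_def)
    qed
    then show ?thesis by blast
  qed
  note big = this
  have "filterlim f at_infinity at_infinity"
    unfolding filterlim_at_infinity[OF order_refl] eventually_at_infinity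
  proof (intro allI impI)
    fix r :: real assume "0 < r"
    define x where "x = max (a + 1) (ln r)"
    have "exp (ln r) \<le> exp x" unfolding exp_le_cancel_iff by (simp add: x_def)
    then have "r \<le> exp x" using \<open>0 < r\<close> by simp
    moreover have "a < x" by (simp add: x_def)
    then obtain M where "\<And>z. cmod z > M \<Longrightarrow> cmod (f z) > exp x" using big by blast
    ultimately have "r \<le> cmod (f z)" if "M + 1 \<le> cmod z" for z
      using that by (smt (verit))
    then show "\<exists>b. \<forall>z. b \<le> cmod z \<longrightarrow> r \<le> cmod (f z)" by blast
  qed
  then show False using transcendental_not_tendsto_infinity[OF tr] by blast
qed

text \<open>
  The image under \<open>G\<close>, a logarithm of the lift through \<open>z\<close>, contains no two points that differ by
  \<open>2 * pi * \<i>\<close>, hence no disc of radius \<open>7 > 2 * pi\<close>. Bloch's theorem, with the constant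
  \<open>1 / 12\<close>, turns this into a bound for the derivative of \<open>G\<close>, whence \<open>84 = 12 * 7\<close>. The usual
  proof gets a better constant from Koebe's quarter theorem.
\<close>
theorem eremenko_lyubich_expansion:
  fixes f :: "complex \<Rightarrow> complex"
  assumes tr: "transcendental_entire f" and sv: "singular_values_within f R" and R: "R > 0"
    and f0: "cmod (f 0) \<le> R" and z: "cmod (f z) > R"
  shows "cmod (f z) * (ln (cmod (f z)) - ln R) \<le> 84 * cmod (z * deriv f z)"
proof -
  have hol: "f holomorphic_on UNIV" using tr by (simp add: transcendental_entire_def)
  define H where "H = {w. ln R < Re w}"
  define b where "b = Ln (f z)"
  define t where "t = Re b - ln R"
  have nz: "f z \<noteq> 0" using z R by auto
  have Reb: "Re b = ln (cmod (f z))" using nz by (simp add: b_def)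
  have t: "t > 0" using z R nz by (simp add: t_def Reb)
  have opH: "open H" "convex H" by (simp_all add: H_def open_halfspace_Re_gt convex_halfspace_Re_gt)
  have bH: "b \<in> H" using t by (simp add: H_def t_def)
  obtain \<Phi> where \<Phi>: "\<Phi> holomorphic_on H" "\<And>w. w \<in> H \<Longrightarrow> f (\<Phi> w) = exp w" "\<Phi> b = z"
    using logarithmic_lift[OF hol sv R, of b z] bH nz unfolding H_def b_def by (auto simp: exp_Ln)
  have large: "cmod (f (\<Phi> w)) > R" if "w \<in> H" for w
    using \<Phi>(2)[OF that] that R unfolding H_def
    by (metis exp_less_cancel_iff exp_ln norm_exp_eq_Re mem_Collect_eq)
  have nz\<Phi>: "\<Phi> w \<noteq> 0" if "w \<in> H" for w using large[OF that] f0 by auto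
  obtain G where G: "G holomorphic_on H" "\<And>w. w \<in> H \<Longrightarrow> \<Phi> w = exp (G w)"
    using contractible_imp_holomorphic_log[OF \<Phi>(1) convex_imp_contractible[OF opH(2)] nz\<Phi>] by metis
  have noshift: False if u: "u \<in> H" "v \<in> H" "G v = G u + 2 * of_real pi * \<i>" for u v
  proof -
    have "\<Phi> v = \<Phi> u" using G(2) u by (simp add: exp_add)
    then have "exp v = exp u" using \<Phi>(2) u by metis
    then obtain n :: int where n: "v = u + of_int (2 * n) * pi * \<i>" using exp_eq by blast
    define \<tau> where "\<tau> = of_int (2 * n) * pi"
    have vn: "v = u + \<i> * of_real \<tau>" using n by (simp add: \<tau>_def)
    have "\<tau> \<noteq> 0"
    proof
      assume "\<tau> = 0"
      then have "v = u" using vn by simp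
      then show False using u(3) by simp
    qed
    have shift: "w + \<i> * of_real \<tau> \<in> H" if "w \<in> H" for w using that by (simp add: H_def)
    have per: "\<Phi> (w + \<i> * of_real \<tau>) = \<Phi> w" if w: "w \<in> H" for w
    proof (rule lift_unique[OF hol, of H "\<lambda>w. \<Phi> (w + \<i> * of_real \<tau>)" \<Phi>])
      show "connected H" using opH(2) by (rule convex_connected)
      show "continuous_on H \<Phi>" using \<Phi>(1) by (rule holomorphic_on_imp_continuous_on)
      then show "continuous_on H (\<lambda>w. \<Phi> (w + \<i> * of_real \<tau>))"
        by (rule continuous_on_compose2) (use shift in \<open>auto intro!: continuous_intros\<close>)
      have "exp (x + \<i> * of_real \<tau>) = exp x" for x
        unfolding exp_eq by (intro exI[of _ n]) (simp add: \<tau>_def)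
      then show "f (\<Phi> (x + \<i> * of_real \<tau>)) = f (\<Phi> x)" if "x \<in> H" for x
        using \<Phi>(2)[OF that] \<Phi>(2)[OF shift[OF that]] by simp
      show "deriv f (\<Phi> (x + \<i> * of_real \<tau>)) \<noteq> 0" if "x \<in> H" for x
        using deriv_nonzero_of_large[OF sv large[OF shift[OF that]]] .
      show "u \<in> H" "\<Phi> (u + \<i> * of_real \<tau>) = \<Phi> u" "w \<in> H"
        using u(1) w \<open>\<Phi> v = \<Phi> u\<close> vn by auto
    qed
    show False
      by (rule logarithmic_lift_not_periodic[OF tr, of \<Phi> "ln R" \<tau>])
        (use \<Phi> \<open>\<tau> \<noteq> 0\<close> per in \<open>auto simp: H_def\<close>)
  qed
  have small: "t * cmod (deriv G b) < 84"
  proof (rule ccontr)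
    assume "\<not> t * cmod (deriv G b) < 84"
    then have r: "7 \<le> t * cmod (deriv G b) / 12" by simp
    have fr: "t \<le> dist b w" if "w \<in> frontier H" for w
    proof -
      have "w \<notin> H" using that opH(1) by (auto simp: frontier_def interior_open)
      then have "t \<le> Re (b - w)" by (simp add: t_def H_def)
      also have "\<dots> \<le> dist b w" unfolding dist_norm by (rule complex_Re_le_cmod)
      finally show ?thesis .
    qed
    obtain c where c: "ball c 7 \<subseteq> G ` H"
      using Bloch_general[OF G(1) bH fr r] by metis
    have "dist c (c + 2 * of_real pi * \<i>) = 2 * pi"
      by (simp add: dist_norm norm_mult)
    then have "c \<in> ball c 7" "c + 2 * of_real pi * \<i> \<in> ball c 7"
      using pi_less_4 pi_approx(2) by auto
    then obtain u v where "u \<in> H" "c = G u" "v \<in> H" "c + 2 * of_real pi * \<i> = G v"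
      using c by blast
    then show False using noshift by metis
  qed
  have dG: "(G has_field_derivative deriv G b) (at b)"
    by (rule holomorphic_derivI[OF G(1) opH(1) bH])
  have df: "(f has_field_derivative deriv f z) (at z)"
    by (rule holomorphic_derivI[OF hol]) auto
  have "((\<lambda>w. f (exp (G w))) has_field_derivative deriv f z * (z * deriv G b)) (at b)"
  proof -
    have "((\<lambda>w. exp (G w)) has_field_derivative exp (G b) * deriv G b) (at b)"
      by (rule DERIV_fun_exp[OF dG])
    moreover have eG: "exp (G b) = z" using G(2)[OF bH] \<Phi>(3) by simp
    ultimately show ?thesis using DERIV_chain2[of f _ "\<lambda>w. exp (G w)" b] df by simp
  qed
  moreover have "eventually (\<lambda>w. w \<in> H) (nhds b)"
    using bH opH(1) by (simp add: eventually_nhds) blast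
  then have "eventually (\<lambda>w. f (exp (G w)) = exp w) (nhds b)"
    by eventually_elim (use G(2) \<Phi>(2) in metis)
  ultimately have "(exp has_field_derivative deriv f z * (z * deriv G b)) (at b)"
    by (subst DERIV_cong_ev[OF refl _ refl, symmetric]) 
  then have "exp b = deriv f z * (z * deriv G b)"
    using DERIV_exp DERIV_unique by blast
  then have "f z = (z * deriv f z) * deriv G b" using nz by (simp add: b_def mult_ac)
  then have "cmod (f z) = cmod (z * deriv f z) * cmod (deriv G b)" by (metis norm_mult)
  then have "cmod (f z) * t = cmod (z * deriv f z) * (t * cmod (deriv G b))" by simp
  also have "\<dots> \<le> cmod (z * deriv f z) * 84" using small by (intro mult_left_mono) auto
  finally show ?thesis by (simp add: t_def Reb mult_ac)
qed

section \<open>Growth and the number of preimages\<close>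

lemma holomorphic_divide_zeros:
  fixes h :: "complex \<Rightarrow> complex"
  assumes "finite Z" "h holomorphic_on UNIV" "\<And>a. a \<in> Z \<Longrightarrow> h a = 0"
  shows "\<exists>g. g holomorphic_on UNIV \<and> (\<forall>z. h z = g z * (\<Prod>a\<in>Z. z - a))"
  using assms(1,3)
proof (induction Z)
  case empty
  then show ?case using assms(2) by auto
next
  case (insert b Z)
  then obtain g where g: "g holomorphic_on UNIV" "\<And>z. h z = g z * (\<Prod>a\<in>Z. z - a)" by auto
  have "(\<Prod>a\<in>Z. b - a) \<noteq> 0" using insert.hyps by auto
  then have gb: "g b = 0" using g(2)[of b] insert.prems by simp
  define q where "q = (\<lambda>z. if z = b then deriv g b else (g z - g b) / (z - b))"
  have "q holomorphic_on UNIV"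
    unfolding q_def by (rule pole_lemma[OF g(1)]) simp
  moreover have "g z = q z * (z - b)" for z by (simp add: q_def gb)
  then have "h z = q z * (\<Prod>a\<in>insert b Z. z - a)" for z
    using g(2) insert.hyps by (simp add: mult.assoc)
  ultimately show ?case by blast
qed

text \<open>
  A substitute for Jensen's formula: divide \<open>h\<close> by the polynomial with the given zeros and
  apply the maximum principle on the circle of radius \<open>4 * r\<close>. There each linear factor has modulus at least
  \<open>3 * r\<close>, while at the origin it has modulus at most \<open>r\<close>, so each zero gains a factor of 3.
\<close>
lemma card_zeros_le:
  fixes h :: "complex \<Rightarrow> complex"
  assumes hol: "h holomorphic_on UNIV" and r: "r > 0"
    and Z: "finite Z" "Z \<subseteq> cball 0 r" "\<And>a. a \<in> Z \<Longrightarrow> h a = 0"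
    and M: "\<And>z. cmod z = 4 * r \<Longrightarrow> cmod (h z) \<le> M"
  shows "3 ^ card Z * cmod (h 0) \<le> M"
proof -
  obtain g where g: "g holomorphic_on UNIV" "\<And>z. h z = g z * (\<Prod>a\<in>Z. z - a)"
    using holomorphic_divide_zeros[OF Z(1) hol Z(3)] by blast
  have M0: "0 \<le> M"
    using order_trans[OF norm_ge_zero M[of "of_real (4 * r)"]] r by simp
  have "cmod (g 0) \<le> M / (3 * r) ^ card Z"
  proof (rule maximum_modulus_frontier[of g "cball 0 (4 * r)"])
    show "g holomorphic_on interior (cball 0 (4 * r))" using g(1) holomorphic_on_subset by blast
    show "continuous_on (closure (cball 0 (4 * r))) g"
      using holomorphic_on_imp_continuous_on[OF g(1)] continuous_on_subset by blast
    show "cmod (g z) \<le> M / (3 * r) ^ card Z" if "z \<in> frontier (cball 0 (4 * r))" for z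
    proof -
      have z: "cmod z = 4 * r" using that r by (simp add: frontier_cball)
      have "3 * r \<le> cmod (z - a)" if "a \<in> Z" for a
        using norm_triangle_ineq2[of z a] z Z(2) that by auto
      then have "(3 * r) ^ card Z \<le> (\<Prod>a\<in>Z. cmod (z - a))"
        using prod_mono[of Z "\<lambda>_. 3 * r" "\<lambda>a. cmod (z - a)"] r by simp
      then have "cmod (g z) * (3 * r) ^ card Z \<le> cmod (g z) * (\<Prod>a\<in>Z. cmod (z - a))"
        by (intro mult_left_mono) auto
      also have "\<dots> = cmod (h z)" by (simp add: g(2) norm_mult prod_norm)
      also have "\<dots> \<le> M" by (rule M[OF z])
      finally show ?thesis using r by (simp add: le_divide_eq)
    qed
  qed (use r in auto)
  moreover have "(\<Prod>a\<in>Z. cmod (0 - a)) \<le> r ^ card Z"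
    using prod_mono[of Z "\<lambda>a. cmod (0 - a)" "\<lambda>_. r"] Z(2) by (force simp: subset_iff)
  ultimately have "cmod (g 0) * (\<Prod>a\<in>Z. cmod (0 - a)) \<le> M / (3 * r) ^ card Z * r ^ card Z"
    using M0 r by (intro mult_mono) (auto intro!: prod_nonneg)
  then have "cmod (h 0) \<le> M / (3 * r) ^ card Z * r ^ card Z"
    by (simp only: g(2)[of 0] norm_mult prod_norm)
  also have "\<dots> = M / 3 ^ card Z" using r by (simp add: power_mult_distrib)
  finally show ?thesis by (simp add: field_simps)
qed

lemma card_preimages_le:
  fixes f :: "complex \<Rightarrow> complex"
  assumes hol: "f holomorphic_on UNIV" and r: "r > 0" and w: "w \<noteq> f 0"
  shows "finite {z \<in> cball 0 r. f z = w}"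
    and "3 ^ card {z \<in> cball 0 r. f z = w} * cmod (w - f 0) \<le> max_modulus f (4 * r) + cmod w"
proof -
  have bd: "3 ^ card Z * cmod (w - f 0) \<le> max_modulus f (4 * r) + cmod w"
    if "finite Z" "Z \<subseteq> {z \<in> cball 0 r. f z = w}" for Z
  proof -
    have "3 ^ card Z * cmod (f 0 - w) \<le> max_modulus f (4 * r) + cmod w"
    proof (rule card_zeros_le[of "\<lambda>z. f z - w" r])
      show "cmod (f z - w) \<le> max_modulus f (4 * r) + cmod w" if "cmod z = 4 * r" for z
        using norm_triangle_ineq4[of "f z" w] norm_le_max_modulus[OF hol that] by linarith
    qed (use that r hol in \<open>auto intro!: holomorphic_intros\<close>)
    then show ?thesis by (simp add: norm_minus_commute)
  qed
  define B where "B = (max_modulus f (4 * r) + cmod w) / cmod (w - f 0)"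
  have "card Z \<le> nat \<lceil>B\<rceil>" if "finite Z" "Z \<subseteq> {z \<in> cball 0 r. f z = w}" for Z
  proof -
    have "real (card Z) \<le> 3 ^ card Z"
      using of_nat_less_two_power[of "card Z", where ?'a = real] power_mono[of 2 "3::real" "card Z"] by linarith
    also have "\<dots> \<le> B" using bd[OF that] w by (simp add: B_def le_divide_eq)
    finally show ?thesis by linarith
  qed
  then show "finite {z \<in> cball 0 r. f z = w}"
    using finite_if_finite_subsets_card_bdd[of "{z \<in> cball 0 r. f z = w}"] by blast
  then show "3 ^ card {z \<in> cball 0 r. f z = w} * cmod (w - f 0) \<le> max_modulus f (4 * r) + cmod w"
    by (rule bd) simp
qed

lemma growth_order_nonneg:
  assumes "transcendental_entire f"
  shows "0 \<le> growth_order f"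
proof -
  obtain R where R: "admissible_radius f R" using ex_admissible_radius[OF assms] by blast
  have "eventually (\<lambda>r. 0 \<le> ereal (ln (ln (max_modulus f r)) / ln r)) at_top"
    using eventually_ge_at_top[of R] eventually_ge_at_top[of "exp 1"]
  proof eventually_elim
    case (elim r)
    have "max_modulus f r > r" using R elim by (simp add: admissible_radius_def)
    then have "exp 1 \<le> max_modulus f r" using elim by simp
    moreover have "0 < r" "0 < max_modulus f r"
      using elim(2) calculation exp_gt_zero[of 1] by linarith+
    ultimately have "1 \<le> ln r" "1 \<le> ln (max_modulus f r)"
      using elim by (simp_all add: ln_ge_iff)
    then show ?case by simp
  qed
  then show ?thesis unfolding growth_order_def by (intro le_Limsup) auto
qed

lemma max_modulus_le_of_growth_order:
  assumes tr: "transcendental_entire f" and "growth_order f < ereal \<beta>"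
  shows "eventually (\<lambda>r. max_modulus f r \<le> exp (r powr \<beta>)) at_top"
proof -
  obtain R where R: "admissible_radius f R" using ex_admissible_radius[OF tr] by blast
  have "eventually (\<lambda>r. ereal (ln (ln (max_modulus f r)) / ln r) < ereal \<beta>) at_top"
    using assms(2) unfolding growth_order_def by (rule Limsup_lessD)
  then show ?thesis
    using eventually_ge_at_top[of R] eventually_ge_at_top[of "exp 1"]
  proof eventually_elim
    case (elim r)
    have "max_modulus f r > r" using R elim by (simp add: admissible_radius_def)
    then have "exp 1 \<le> max_modulus f r" using elim by simp
    moreover have pos: "0 < r" "0 < max_modulus f r"
      using elim(3) calculation exp_gt_zero[of 1] by linarith+
    ultimately have ge: "1 \<le> ln r" "1 \<le> ln (max_modulus f r)"
      using elim by (simp_all add: ln_ge_iff)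
    have "ln (ln (max_modulus f r)) < \<beta> * ln r" using elim(1) ge by (simp add: divide_less_eq)
    then have "exp (ln (ln (max_modulus f r))) < exp (\<beta> * ln r)" by simp
    moreover have "exp (ln (ln (max_modulus f r))) = ln (max_modulus f r)" using ge by (intro exp_ln) linarith
    ultimately have "ln (max_modulus f r) < r powr \<beta>" using ge pos by (simp add: powr_def)
    then have "exp (ln (max_modulus f r)) \<le> exp (r powr \<beta>)" by simp
    then show ?case using pos by simp
  qed
qed

text \<open>
  For \<open>w\<close> of large modulus, the term \<open>cmod w\<close> that \<open>card_preimages_le\<close> adds to the maximum modulus
  cancels against \<open>cmod (w - f 0)\<close>, so the bound does not depend on \<open>w\<close>.
\<close>
lemma card_preimages_le_growth:
  fixes f :: "complex \<Rightarrow> complex" and l r B :: real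
  assumes hol: "f holomorphic_on UNIV" and r: "0 < r"
    and w: "cmod w \<ge> 1" "cmod w \<ge> 2 * cmod (f 0)"
    and M: "max_modulus f (4 * r) \<le> exp B" and B: "B \<ge> 0"
  shows "finite {z \<in> cball 0 r. f z = w}" and "real (card {z \<in> cball 0 r. f z = w}) \<le> 2 + B"
proof -
  have ne: "w \<noteq> f 0" using w by auto
  define n where "n = card {z \<in> cball 0 r. f z = w}"
  have n: "3 ^ n * cmod (w - f 0) \<le> max_modulus f (4 * r) + cmod w"
    unfolding n_def by (rule card_preimages_le(2)[OF hol r ne])
  have "cmod w / 2 \<le> cmod (w - f 0)" using norm_triangle_ineq2[of w "f 0"] w by linarith
  then have "3 ^ n * (cmod w / 2) \<le> 3 ^ n * cmod (w - f 0)" by (intro mult_left_mono) auto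
  also have "\<dots> \<le> exp B + cmod w" using n M by linarith
  also have "\<dots> \<le> exp B * cmod w + exp B * cmod w"
  proof (rule add_mono)
    show "exp B \<le> exp B * cmod w" using w(1) by simp
    show "cmod w \<le> exp B * cmod w" using B w(1) mult_right_mono[of 1 "exp B" "cmod w"] by simp
  qed
  finally have "3 ^ n * cmod w \<le> (4 * exp B) * cmod w" by (simp add: mult_ac)
  then have n3: "3 ^ n \<le> 4 * exp B" by (rule mult_right_le_imp_le) (use w in linarith)
  have "exp (real n) = exp 1 ^ n" using exp_of_nat_mult[of n "1::real"] by simp
  also have "\<dots> \<le> 3 ^ n" by (intro power_mono exp_le) simp
  also note n3
  also have "4 * exp B \<le> exp 2 * exp B"
  proof (rule mult_right_mono)
    have "(2::real) * 2 \<le> exp 1 * exp 1"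
      using exp_ge_add_one_self[of 1] by (intro mult_mono) auto
    then show "(4::real) \<le> exp 2" by (simp flip: exp_add)
  qed simp
  finally have "exp (real n) \<le> exp (2 + B)" by (simp add: exp_add)
  then show "real (card {z \<in> cball 0 r. f z = w}) \<le> 2 + B" by (simp add: n_def)
  show "finite {z \<in> cball 0 r. f z = w}" by (rule card_preimages_le(1)[OF hol r ne])
qed

section \<open>Change of variables for holomorphic maps\<close>

text \<open>
  The identification of the plane with \<open>real^2\<close> preserves Lebesgue measure and turns complex
  differentiability into real differentiability, with a Jacobian matrix.
\<close>
definition complex_of_vec :: "real^2 \<Rightarrow> complex" where
  "complex_of_vec v = Complex (v $ 1) (v $ 2)"

definition vec_of_complex :: "complex \<Rightarrow> real^2" where
  "vec_of_complex z = vector [Re z, Im z]"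

lemma vec_of_complex_nth [simp]: "vec_of_complex z $ 1 = Re z" "vec_of_complex z $ 2 = Im z"
  by (simp_all add: vec_of_complex_def)

lemma complex_of_vec_inverse [simp]: "vec_of_complex (complex_of_vec v) = v"
  by (simp add: vec_eq_iff forall_2 complex_of_vec_def)

lemma vec_of_complex_inverse [simp]: "complex_of_vec (vec_of_complex z) = z"
  by (simp add: complex_of_vec_def)

lemma bounded_linear_complex_of_vec: "bounded_linear complex_of_vec"
  unfolding linear_conv_bounded_linear[symmetric] linear_iff
  by (simp add: complex_of_vec_def complex_eq_iff)

lemma bounded_linear_vec_of_complex: "bounded_linear vec_of_complex"
  unfolding linear_conv_bounded_linear[symmetric] linear_iff
  by (simp add: vec_eq_iff forall_2)

lemma measurable_complex_of_vec [measurable]: "complex_of_vec \<in> borel \<rightarrow>\<^sub>M borel"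
  by (intro borel_measurable_continuous_onI linear_continuous_on bounded_linear_complex_of_vec)

lemma lborel_complex_distr: "(lborel :: complex measure) = distr lborel borel complex_of_vec"
proof (rule lborel_eqI)
  fix l u :: complex assume le: "\<And>b. b \<in> Basis \<Longrightarrow> l \<bullet> b \<le> u \<bullet> b"
  have le': "Re l \<le> Re u" "Im l \<le> Im u"
    using le[of 1] le[of \<i>] by (auto simp: Basis_complex_def inner_complex_def)
  have bas: "(Basis :: (real^2) set) = {axis 1 1, axis 2 1}"
    by (auto simp: Basis_vec_def UNIV_2)
  have ne: "axis 1 1 \<noteq> (axis 2 1 :: real^2)"
    by (simp add: axis_eq_axis)
  have "complex_of_vec -` box l u = box (vec_of_complex l) (vec_of_complex u)"
    by (auto simp: box_def bas Basis_complex_def inner_axis complex_of_vec_def inner_complex_def)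
  then have "emeasure (distr lborel borel complex_of_vec) (box l u) =
      emeasure lborel (box (vec_of_complex l) (vec_of_complex u))"
    by (simp add: emeasure_distr)
  also have "\<dots> = (\<Prod>b\<in>Basis. (vec_of_complex u - vec_of_complex l) \<bullet> b)"
    by (rule emeasure_lborel_box) (use le' in \<open>auto simp: bas inner_axis\<close>)
  also have "(\<Prod>b\<in>Basis. (vec_of_complex u - vec_of_complex l) \<bullet> b) = (\<Prod>b\<in>Basis. (u - l) \<bullet> b)"
    using ne by (simp add: bas inner_axis Basis_complex_def inner_complex_def)
  finally show "emeasure (distr lborel borel complex_of_vec) (box l u) = (\<Prod>b\<in>Basis. (u - l) \<bullet> b)" .
qed simp

text \<open>
  The Jacobian determinant of a holomorphic map is the squared modulus of its derivative. If the
  integral is infinite, then so is the area, since a finite area would make the Jacobian integrable.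
\<close>
lemma area_holomorphic_image:
  fixes f :: "complex \<Rightarrow> complex"
  assumes hol: "f holomorphic_on U" and U: "open U" and S: "S \<subseteq> U" "S \<in> sets borel"
    and inj: "inj_on f S" and fS: "f ` S \<in> sets borel"
  shows "emeasure lborel (f ` S) = (\<integral>\<^sup>+z. ennreal (indicator S z * (cmod (deriv f z))\<^sup>2) \<partial>lborel)"
proof -
  define T where "T = complex_of_vec -` S"
  define F where "F = (\<lambda>v. vec_of_complex (f (complex_of_vec v)))"
  define F' where "F' = (\<lambda>v h. vec_of_complex (deriv f (complex_of_vec v) * complex_of_vec h))"
  define J where "J = (\<lambda>v. (cmod (deriv f (complex_of_vec v)))\<^sup>2)"
  have T: "T \<in> sets borel"
    unfolding T_def using measurable_sets_borel[OF measurable_complex_of_vec S(2)] .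
  have FT: "F ` T = complex_of_vec -` (f ` S)"
  proof safe
    fix v assume "v \<in> T"
    then show "F v \<in> complex_of_vec -` (f ` S)" by (simp add: F_def T_def)
  next
    fix v z assume "complex_of_vec v = f z" "z \<in> S"
    then have "F (vec_of_complex z) = v" "vec_of_complex z \<in> T"
      by (simp_all add: F_def T_def flip: \<open>complex_of_vec v = f z\<close>)
    then show "v \<in> F ` T" by blast
  qed
  have der: "(F has_derivative F' v) (at v within T)" if "v \<in> T" for v
  proof -
    have "complex_of_vec v \<in> U" using that S by (auto simp: T_def)
    then have "(f has_field_derivative deriv f (complex_of_vec v)) (at (complex_of_vec v))"
      using holomorphic_derivI[OF hol U] by simp
    then have d: "(f has_derivative (\<lambda>h. deriv f (complex_of_vec v) * h)) (at (complex_of_vec v))"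
      by (simp add: has_field_derivative_def)
    have "(vec_of_complex \<circ> (f \<circ> complex_of_vec) has_derivative
        vec_of_complex \<circ> ((\<lambda>h. deriv f (complex_of_vec v) * h) \<circ> complex_of_vec)) (at v)"
      by (intro diff_chain_at bounded_linear_imp_has_derivative bounded_linear_complex_of_vec
          bounded_linear_vec_of_complex d)
    then show ?thesis
      unfolding F_def F'_def by (simp add: o_def has_derivative_at_withinI)
  qed
  have det: "\<bar>det (matrix (F' v))\<bar> = J v" for v
  proof -
    have c: "complex_of_vec (axis 1 1) = 1" "complex_of_vec (axis 2 1) = \<i>"
      by (auto simp: complex_of_vec_def axis_def complex_eq_iff)
    have "det (matrix (F' v)) = J v"
      by (simp add: det_2 matrix_def F'_def c J_def cmod_power2) (simp add: power2_eq_square)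
    then show ?thesis by (simp add: J_def)
  qed
  have injF: "inj_on F T"
    using inj unfolding inj_on_def F_def T_def by (metis complex_of_vec_inverse vec_of_complex_inverse vimageE)
  have mJ: "(\<lambda>v. indicator T v * J v) \<in> borel_measurable borel"
  proof -
    have "continuous_on S (\<lambda>z. (cmod (deriv f z))\<^sup>2)"
      using holomorphic_on_imp_continuous_on[OF holomorphic_deriv[OF hol U]] S(1)
      by (intro continuous_intros) (rule continuous_on_subset)
    then have [measurable]: "(\<lambda>z. indicator S z *\<^sub>R (cmod (deriv f z))\<^sup>2) \<in> borel_measurable borel"
      by (rule borel_measurable_continuous_on_indicator[OF S(2)])
    have "(\<lambda>v. indicator S (complex_of_vec v) *\<^sub>R (cmod (deriv f (complex_of_vec v)))\<^sup>2) \<in> borel_measurable borel"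
      by measurable
    then show ?thesis by (simp add: J_def T_def indicator_def)
  qed
  have int: "(\<integral>\<^sup>+z. ennreal (indicator S z * (cmod (deriv f z))\<^sup>2) \<partial>lborel) = (\<integral>\<^sup>+v. ennreal (indicator T v * J v) \<partial>lborel)"
  proof -
    have "continuous_on S (\<lambda>z. (cmod (deriv f z))\<^sup>2)"
      using holomorphic_on_imp_continuous_on[OF holomorphic_deriv[OF hol U]] S(1)
      by (intro continuous_intros) (rule continuous_on_subset)
    then have "(\<lambda>z. indicator S z *\<^sub>R (cmod (deriv f z))\<^sup>2) \<in> borel_measurable borel"
      by (rule borel_measurable_continuous_on_indicator[OF S(2)])
    then have [measurable]: "(\<lambda>z. indicator S z * (cmod (deriv f z))\<^sup>2) \<in> borel_measurable borel"
      by (simp only: real_scaleR_def)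
    have "(\<integral>\<^sup>+z. ennreal (indicator S z * (cmod (deriv f z))\<^sup>2) \<partial>lborel) =
        (\<integral>\<^sup>+v. ennreal (indicator S (complex_of_vec v) * (cmod (deriv f (complex_of_vec v)))\<^sup>2) \<partial>lborel)"
      by (subst lborel_complex_distr, rule nn_integral_distr) measurable
    then show ?thesis by (simp add: J_def T_def indicator_def)
  qed
  have em: "emeasure lborel (f ` S) = emeasure lborel (F ` T)"
    by (subst lborel_complex_distr) (use fS in \<open>simp add: emeasure_distr FT\<close>)
  have FTb: "F ` T \<in> sets borel"
    unfolding FT using measurable_sets_borel[OF measurable_complex_of_vec fS] .
  have Tl: "T \<in> sets lebesgue" using T by auto
  note key = has_measure_differentiable_image[OF Tl der injF, unfolded det]
  have "emeasure lborel (F ` T) = (\<integral>\<^sup>+v. ennreal (indicator T v * J v) \<partial>lborel)"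
  proof (cases "(\<integral>\<^sup>+v. ennreal (indicator T v * J v) \<partial>lborel)")
    case (real r)
    have "((\<lambda>v. indicator T v * J v) has_integral r) UNIV"
      by (rule nn_integral_has_integral[OF mJ]) (use real in \<open>auto simp: J_def\<close>)
    moreover have "(\<lambda>v. indicator T v * J v) = (\<lambda>v. if v \<in> T then J v else 0)"
      by (auto simp: indicator_def)
    ultimately have "(J has_integral r) T"
      by (simp add: has_integral_restrict_UNIV)
    then have "F ` T \<in> lmeasurable" "measure lebesgue (F ` T) = r" using key by auto
    then have "emeasure lebesgue (F ` T) = ennreal r"
      by (simp add: emeasure_eq_measure2 fmeasurableD2)
    then show ?thesis using real FTb by simp
  next
    case top
    have "emeasure lborel (F ` T) = \<infinity>"
    proof (rule ccontr)
      assume "emeasure lborel (F ` T) \<noteq> \<infinity>"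
      then have "F ` T \<in> lmeasurable"
        using FTb by (intro fmeasurableI) (auto simp: less_top)
      then have "(J has_integral measure lebesgue (F ` T)) T" using key by blast
      then have "(\<integral>\<^sup>+v. ennreal (indicator T v * J v) \<partial>lborel) = ennreal (measure lebesgue (F ` T))"
        by (intro nn_integral_has_integral_lebesgue) (auto simp: J_def)
      then show False using top by simp
    qed
    then show ?thesis using top by simp
  qed
  then show ?thesis using em int by simp
qed


lemma sets_borel_holomorphic_image:
  fixes f :: "complex \<Rightarrow> complex"
  assumes hol: "f holomorphic_on B" and B: "open B" "inj_on f B" and P: "P \<subseteq> B" "P \<in> sets borel"
  shows "f ` P \<in> sets borel"
proof -
  obtain g where g: "g holomorphic_on f ` B" and gf: "\<And>x. x \<in> B \<Longrightarrow> g (f x) = x"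
    using holomorphic_has_inverse[OF hol B] by metis
  have op: "open (f ` B)" using open_mapping_thm3[OF hol B] .
  have "(\<lambda>w. indicator (f ` B) w *\<^sub>R g w) \<in> borel_measurable borel"
    using op holomorphic_on_imp_continuous_on[OF g]
    by (intro borel_measurable_continuous_on_indicator) auto
  from measurable_sets_borel[OF this P(2)]
  have "(\<lambda>w. indicator (f ` B) w *\<^sub>R g w) -` P \<inter> f ` B \<in> sets borel"
    using op by (intro sets.Int) auto
  also have "(\<lambda>w. indicator (f ` B) w *\<^sub>R g w) -` P \<inter> f ` B = f ` P"
    using P(1) gf by auto
  finally show ?thesis .
qed

text \<open>
  The area formula says that two measures agree on all Borel sets, namely the push-forward
  under \<open>f\<close> of the measure with density the Jacobian on \<open>P\<close>, and Lebesgue measure restricted to \<open>f ` P\<close>.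
  Integrating \<open>h\<close> against both gives the claim.
\<close>
lemma nn_integral_injective_holomorphic:
  fixes f :: "complex \<Rightarrow> complex" and h :: "complex \<Rightarrow> ennreal"
  assumes hol: "f holomorphic_on UNIV" and B: "open B" "inj_on f B"
    and P: "P \<subseteq> B" "P \<in> sets borel" and h [measurable]: "h \<in> borel_measurable borel"
  shows "(\<integral>\<^sup>+z. ennreal (indicator P z * (cmod (deriv f z))\<^sup>2) * h (f z) \<partial>lborel) =
         (\<integral>\<^sup>+w. indicator (f ` P) w * h w \<partial>lborel)"
proof -
  have holB: "f holomorphic_on B" using hol holomorphic_on_subset by blast
  have [measurable]: "f \<in> borel_measurable borel"
    by (intro borel_measurable_continuous_onI holomorphic_on_imp_continuous_on hol)
  have [measurable]: "deriv f \<in> borel_measurable borel"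
    by (intro borel_measurable_continuous_onI holomorphic_on_imp_continuous_on holomorphic_deriv hol open_UNIV)
  note [measurable] = P(2)
  have [measurable]: "f ` P \<in> sets borel"
    by (rule sets_borel_holomorphic_image[OF holB B P])
  define J where "J = (\<lambda>z. ennreal (indicator P z * (cmod (deriv f z))\<^sup>2))"
  have [measurable]: "J \<in> borel_measurable borel" unfolding J_def by measurable
  have "distr (density lborel J) borel f = density lborel (indicator (f ` P))"
  proof (rule measure_eqI)
    fix A assume "A \<in> sets (distr (density lborel J) borel f)"
    then have A [measurable]: "A \<in> sets borel" by simp
    have pre [measurable]: "f -` A \<in> sets borel"
      using measurable_sets_borel[of f borel A] by simp
    have "emeasure (distr (density lborel J) borel f) A = emeasure (density lborel J) (f -` A)"
      by (simp add: emeasure_distr)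
    also have "\<dots> = (\<integral>\<^sup>+z. J z * indicator (f -` A) z \<partial>lborel)"
      by (simp add: emeasure_density)
    also have "\<dots> = (\<integral>\<^sup>+z. ennreal (indicator (P \<inter> f -` A) z * (cmod (deriv f z))\<^sup>2) \<partial>lborel)"
      by (intro nn_integral_cong) (auto simp: J_def indicator_def)
    also have "\<dots> = emeasure lborel (f ` (P \<inter> f -` A))"
    proof (rule area_holomorphic_image[symmetric, OF hol open_UNIV])
      show "inj_on f (P \<inter> f -` A)" using B(2) P(1) by (auto simp: inj_on_def)
      show "f ` (P \<inter> f -` A) \<in> sets borel"
        by (rule sets_borel_holomorphic_image[OF holB B]) (use P(1) in auto)
    qed auto
    also have "f ` (P \<inter> f -` A) = f ` P \<inter> A" by auto
    also have "emeasure lborel (f ` P \<inter> A) = emeasure (density lborel (indicator (f ` P))) A"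
      by (simp add: emeasure_density Int_commute flip: indicator_inter_arith)
    finally show "emeasure (distr (density lborel J) borel f) A =
      emeasure (density lborel (indicator (f ` P))) A" .
  qed simp
  then have "(\<integral>\<^sup>+w. h w \<partial>distr (density lborel J) borel f) =
      (\<integral>\<^sup>+w. h w \<partial>density lborel (indicator (f ` P)))" by simp
  then show ?thesis
    by (simp add: nn_integral_distr nn_integral_density J_def)
qed

text \<open>
  Without critical points, \<open>G\<close> splits into countably many Borel pieces on each of which \<open>f\<close> is
  injective. Summing the integrals over the images of the pieces counts each \<open>w\<close> at most as
  often as it has preimages in \<open>G\<close>.
\<close>
lemma nn_integral_holomorphic_le_multiplicity:
  fixes f :: "complex \<Rightarrow> complex" and h k :: "complex \<Rightarrow> ennreal"
  assumes hol: "f holomorphic_on UNIV" and G: "G \<in> sets borel" "\<And>z. z \<in> G \<Longrightarrow> deriv f z \<noteq> 0"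
    and h [measurable]: "h \<in> borel_measurable borel"
    and fin: "\<And>w. finite {z \<in> G. f z = w}"
    and k: "\<And>w. of_nat (card {z \<in> G. f z = w}) * h w \<le> k w"
  shows "(\<integral>\<^sup>+z. ennreal (indicator G z * (cmod (deriv f z))\<^sup>2) * h (f z) \<partial>lborel) \<le> (\<integral>\<^sup>+w. k w \<partial>lborel)"
proof -
  have [measurable]: "f \<in> borel_measurable borel"
    by (intro borel_measurable_continuous_onI holomorphic_on_imp_continuous_on hol)
  have [measurable]: "deriv f \<in> borel_measurable borel"
    by (intro borel_measurable_continuous_onI holomorphic_on_imp_continuous_on holomorphic_deriv hol open_UNIV)
  obtain F where F: "F \<subseteq> {U. open U \<and> inj_on f U}" "countable F"
    and UF: "\<Union>F = \<Union>{U. open U \<and> inj_on f U}"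
    using Lindelof[of "{U. open U \<and> inj_on f U}"] by blast
  define B where "B = from_nat_into (insert {} F)"
  have rB: "range B = insert {} F"
    unfolding B_def by (rule range_from_nat_into) (use F in auto)
  have B: "open (B n)" "inj_on f (B n)" for n
    using rB F(1) by (metis (no_types, lifting) insert_iff inj_on_empty mem_Collect_eq open_empty rangeI subsetD)+
  have GB: "G \<subseteq> (\<Union>n. B n)"
  proof
    fix z assume "z \<in> G"
    then obtain r where "r > 0" "inj_on f (ball z r)"
      using has_complex_derivative_locally_injective[OF hol UNIV_I open_UNIV] G(2) by metis
    then have "z \<in> \<Union>{U. open U \<and> inj_on f U}" by (auto intro!: exI[of _ "ball z r"])
    then show "z \<in> (\<Union>n. B n)" using UF rB by auto
  qed
  define P where "P = (\<lambda>n. disjointed B n \<inter> G)"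
  have "range (disjointed B) \<subseteq> sets borel"
    by (rule sets.range_disjointed_sets) (use B(1) in auto)
  then have Pb [measurable]: "P n \<in> sets borel" for n
    unfolding P_def using G(1) by (intro sets.Int) auto
  have PB: "P n \<subseteq> B n" for n
    unfolding P_def by (rule order_trans[OF Int_lower1 disjointed_subset])
  have disj: "disjoint_family P"
    unfolding P_def using disjoint_family_disjointed[of B] by (auto simp: disjoint_family_on_def)
  have UP: "(\<Union>n. P n) = G" unfolding P_def using GB UN_disjointed_eq[of B] by auto
  have fP [measurable]: "f ` P n \<in> sets borel" for n
    by (rule sets_borel_holomorphic_image[OF holomorphic_on_subset[OF hol] B PB Pb]) auto
  have one: "m = n" if "z \<in> P m" "z \<in> P n" for z m n
    using disj that unfolding disjoint_family_on_def by blast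
  have "(\<integral>\<^sup>+z. ennreal (indicator G z * (cmod (deriv f z))\<^sup>2) * h (f z) \<partial>lborel) =
     (\<integral>\<^sup>+z. (\<Sum>n. ennreal (indicator (P n) z * (cmod (deriv f z))\<^sup>2) * h (f z)) \<partial>lborel)"
  proof (rule nn_integral_cong)
    fix z
    show "ennreal (indicator G z * (cmod (deriv f z))\<^sup>2) * h (f z) =
        (\<Sum>n. ennreal (indicator (P n) z * (cmod (deriv f z))\<^sup>2) * h (f z))"
    proof (cases "z \<in> G")
      case True
      then obtain n where n: "z \<in> P n" using UP by auto
      have "(\<Sum>m. ennreal (indicator (P m) z * (cmod (deriv f z))\<^sup>2) * h (f z)) =
        (\<Sum>m\<in>{n}. ennreal (indicator (P m) z * (cmod (deriv f z))\<^sup>2) * h (f z))"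
        by (rule suminf_finite) (use one n in \<open>auto simp: indicator_def\<close>)
      then show ?thesis using True n by simp
    next
      case False
      then have "z \<notin> P n" for n using UP by auto
      then show ?thesis using False by simp
    qed
  qed
  also have "\<dots> = (\<Sum>n. \<integral>\<^sup>+z. ennreal (indicator (P n) z * (cmod (deriv f z))\<^sup>2) * h (f z) \<partial>lborel)"
    by (rule nn_integral_suminf) measurable
  also have "\<dots> = (\<Sum>n. \<integral>\<^sup>+w. indicator (f ` P n) w * h w \<partial>lborel)"
    by (simp add: nn_integral_injective_holomorphic[OF hol B PB Pb h])
  also have "\<dots> = (\<integral>\<^sup>+w. (\<Sum>n. indicator (f ` P n) w * h w) \<partial>lborel)"
    by (rule nn_integral_suminf[symmetric]) measurable
  also have "\<dots> \<le> (\<integral>\<^sup>+w. k w \<partial>lborel)"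
  proof (rule nn_integral_mono)
    fix w
    define Z where "Z = {z \<in> G. f z = w}"
    define Q where "Q = {n. w \<in> f ` P n}"
    have "\<forall>n. \<exists>z. n \<in> Q \<longrightarrow> z \<in> P n \<and> f z = w" by (auto simp: Q_def)
    then obtain s where s: "\<And>n. n \<in> Q \<Longrightarrow> s n \<in> P n \<and> f (s n) = w" by metis
    have sZ: "s ` Q \<subseteq> Z" using s UP by (auto simp: Z_def)
    have injs: "inj_on s Q" using s one by (metis inj_onI)
    have finQ: "finite Q" "card Q \<le> card Z"
      using inj_on_finite[OF injs sZ] card_inj_on_le[OF injs sZ] fin by (auto simp: Z_def)
    have "(\<Sum>n. indicator (f ` P n) w * h w) = (\<Sum>n\<in>Q. indicator (f ` P n) w * h w)"
      by (rule suminf_finite) (use finQ in \<open>auto simp: Q_def indicator_def\<close>)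
    also have "\<dots> = of_nat (card Q) * h w" by (simp add: Q_def)
    also have "\<dots> \<le> of_nat (card Z) * h w"
      using finQ(2) by (intro mult_right_mono) auto
    also have "\<dots> \<le> k w" using k by (simp add: Z_def)
    finally show "(\<Sum>n. indicator (f ` P n) w * h w) \<le> k w" .
  qed
  finally show ?thesis .
qed

section \<open>Logarithmic area\<close>

text \<open>
  Integration against Lebesgue measure and against its completion agree for all
  nonnegative functions, so everything below can be computed with Borel measure.
\<close>
lemma logarea_lborel: "logarea A = (\<integral>\<^sup>+z. ennreal (1 / (cmod z)\<^sup>2) * indicator A z \<partial>lborel)"
  unfolding logarea_def by (simp add: nn_integral_completion)

lemma logarea_mono: "A \<subseteq> B \<Longrightarrow> logarea A \<le> logarea B"
  unfolding logarea_def by (intro nn_integral_mono) (auto simp: indicator_def)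

lemma logarea_UN_le:
  assumes [measurable]: "\<And>n::nat. A n \<in> sets borel"
  shows "logarea (\<Union>n. A n) \<le> (\<Sum>n. logarea (A n))"
proof -
  have "logarea (\<Union>n. A n) \<le> (\<integral>\<^sup>+z. (\<Sum>n. ennreal (1 / (cmod z)\<^sup>2) * indicator (A n) z) \<partial>lborel)"
    unfolding logarea_lborel
  proof (rule nn_integral_mono)
    fix z
    show "ennreal (1 / (cmod z)\<^sup>2) * indicator (\<Union>n. A n) z \<le> (\<Sum>n. ennreal (1 / (cmod z)\<^sup>2) * indicator (A n) z)"
    proof (cases "z \<in> (\<Union>n. A n)")
      case True
      then obtain m where "z \<in> A m" by blast
      then have "ennreal (1 / (cmod z)\<^sup>2) = (\<Sum>n\<in>{m}. ennreal (1 / (cmod z)\<^sup>2) * indicator (A n) z)" by simp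
      also have "\<dots> \<le> (\<Sum>n. ennreal (1 / (cmod z)\<^sup>2) * indicator (A n) z)"
        by (rule sum_le_suminf) auto
      finally show ?thesis using True by simp
    qed simp
  qed
  also have "\<dots> = (\<Sum>n. logarea (A n))"
    unfolding logarea_lborel by (rule nn_integral_suminf) measurable
  finally show ?thesis .
qed

lemma logarea_Un_le:
  assumes [measurable]: "A \<in> sets borel" "B \<in> sets borel"
  shows "logarea (A \<union> B) \<le> logarea A + logarea B"
proof -
  have "logarea (A \<union> B) \<le> (\<integral>\<^sup>+z. ennreal (1 / (cmod z)\<^sup>2) * indicator A z + ennreal (1 / (cmod z)\<^sup>2) * indicator B z \<partial>lborel)"
    unfolding logarea_lborel by (rule nn_integral_mono) (auto simp: indicator_def)
  also have "\<dots> = logarea A + logarea B"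
    unfolding logarea_lborel by (rule nn_integral_add) measurable
  finally show ?thesis .
qed

lemma logarea_bounded_annulus_finite: "logarea {z \<in> \<Delta>. cmod z < \<sigma>} < \<infinity>"
proof -
  have "logarea {z \<in> \<Delta>. cmod z < \<sigma>} \<le> (\<integral>\<^sup>+z. indicator (ball (0::complex) \<sigma>) z \<partial>lborel)"
    unfolding logarea_lborel
  proof (rule nn_integral_mono)
    fix z
    have "1 / (cmod z)\<^sup>2 \<le> 1" if "1 \<le> cmod z"
      using one_le_power[OF that, of 2] by (simp add: divide_le_eq)
    then show "ennreal (1 / (cmod z)\<^sup>2) * indicator {z \<in> \<Delta>. cmod z < \<sigma>} z \<le> indicator (ball 0 \<sigma>) z"
      by (auto simp: indicator_def Delta_def)
  qed
  also have "\<dots> < \<infinity>" using emeasure_bounded_finite[OF bounded_ball, of 0 \<sigma>] by simp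
  finally show ?thesis .
qed

section \<open>Preimages lose logarithmic area\<close>

lemma borel_measurable_entire:
  fixes f :: "complex \<Rightarrow> complex"
  assumes "f holomorphic_on UNIV"
  shows "f \<in> borel_measurable borel"
  by (intro borel_measurable_continuous_onI holomorphic_on_imp_continuous_on assms)

text \<open>
  The sum over the preimages \<open>z\<close> of \<open>w\<close> of the squared moduli of \<open>f z / (z * f' z)\<close> is the density
  of the pulled back logarithmic area with respect to the logarithmic area at \<open>w\<close>. With
  \<open>l = ln (cmod w)\<close> it has at most \<open>2 + 4 powr \<beta> * l powr (\<beta> / \<alpha>)\<close> terms, each at most
  \<open>(168 / l)\<^sup>2\<close>. This tends to zero because \<open>\<beta> / \<alpha> < 2\<close>.
\<close>
lemma logarea_preimage_contraction:
  fixes f :: "complex \<Rightarrow> complex" and \<alpha> \<beta> R :: real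
  assumes tr: "transcendental_entire f" and sv: "singular_values_within f R"
    and R: "R > 0" "cmod (f 0) \<le> R"
    and growth: "eventually (\<lambda>r. max_modulus f r \<le> exp (r powr \<beta>)) at_top"
    and \<alpha>: "0 < \<alpha>" "0 < \<beta>" "\<beta> < 2 * \<alpha>"
  shows "eventually (\<lambda>\<sigma>. \<forall>A \<in> sets borel.
    logarea {z. \<sigma> \<le> cmod z \<and> exp (cmod z powr \<alpha>) \<le> cmod (f z) \<and> f z \<in> A} \<le> ennreal (1/2) * logarea A) at_top"
proof -
  have hol: "f holomorphic_on UNIV" using tr by (simp add: transcendental_entire_def)
  define q where "q = \<beta> / \<alpha>"
  define C where "C = 4 powr \<beta>"
  have q: "0 < q" "q < 2" using \<alpha> by (auto simp: q_def divide_less_eq)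
  have C: "C > 0" by (simp add: C_def)
  obtain r1 where r1: "\<And>r. r \<ge> r1 \<Longrightarrow> max_modulus f r \<le> exp (r powr \<beta>)"
    using growth by (auto simp: eventually_at_top_linorder)
  \<comment> \<open>Here \<open>28224 = 168\<^sup>2\<close>, where \<open>168 = 2 * 84\<close> stems from \<open>l - ln R \<ge> l / 2\<close>, and
    \<open>56448 = 2 * 28224\<close> yields the factor one half.\<close>
  have "eventually (\<lambda>l::real. 56448 * (2 + C * l powr q) \<le> l\<^sup>2) at_top"
    using q C by real_asymp
  moreover have "eventually (\<lambda>l::real. 4 * l powr (1 / \<alpha>) \<ge> r1) at_top"
  proof -
    have "filterlim (\<lambda>l::real. 4 * l powr (1 / \<alpha>)) at_top at_top" using \<alpha> by real_asymp
    then show ?thesis by (simp add: filterlim_at_top)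
  qed
  moreover have "eventually (\<lambda>l::real. exp l \<ge> 2 * cmod (f 0) + R + 1) at_top"
    using exp_at_top by (simp add: filterlim_at_top)
  moreover have "eventually (\<lambda>l::real. l \<ge> 1) at_top" "eventually (\<lambda>l::real. l \<ge> 2 * ln R) at_top"
    by (rule eventually_ge_at_top)+
  ultimately have "eventually (\<lambda>l::real. 56448 * (2 + C * l powr q) \<le> l\<^sup>2 \<and> 4 * l powr (1 / \<alpha>) \<ge> r1 \<and>
     exp l \<ge> 2 * cmod (f 0) + R + 1 \<and> l \<ge> 1 \<and> l \<ge> 2 * ln R) at_top"
    by eventually_elim blast
  then obtain l0 where l0: "\<And>l. l \<ge> l0 \<Longrightarrow> 56448 * (2 + C * l powr q) \<le> l\<^sup>2"
    "\<And>l. l \<ge> l0 \<Longrightarrow> 4 * l powr (1 / \<alpha>) \<ge> r1"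
    "\<And>l. l \<ge> l0 \<Longrightarrow> exp l \<ge> 2 * cmod (f 0) + R + 1"
    "\<And>l. l \<ge> l0 \<Longrightarrow> l \<ge> 1" "\<And>l. l \<ge> l0 \<Longrightarrow> l \<ge> 2 * ln R"
    by (auto simp: eventually_at_top_linorder)
  have "eventually (\<lambda>\<sigma>::real. \<sigma> powr \<alpha> \<ge> l0) at_top"
  proof -
    have "filterlim (\<lambda>\<sigma>::real. \<sigma> powr \<alpha>) at_top at_top" using \<alpha> by real_asymp
    then show ?thesis by (simp add: filterlim_at_top)
  qed
  then show ?thesis
    using eventually_ge_at_top[of 1]
  proof eventually_elim
    case (elim \<sigma>)
    show ?case
    proof
      fix A :: "complex set" assume A [measurable]: "A \<in> sets borel"
      note [measurable] = borel_measurable_entire[OF hol]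
      define G where "G = {z. \<sigma> \<le> cmod z \<and> exp (cmod z powr \<alpha>) \<le> cmod (f z) \<and> f z \<in> A}"
      define h where "h = (\<lambda>w. ennreal (28224 / ((cmod w)\<^sup>2 * (ln (cmod w))\<^sup>2)))"
      define k where "k = (\<lambda>w. ennreal (1/2) * (ennreal (1 / (cmod w)\<^sup>2) * indicator A w))"
      have Gb: "G \<in> sets borel" unfolding G_def by measurable
      have G: "cmod z > 0" "ln (cmod (f z)) \<ge> l0" "cmod (f z) \<ge> 2 * cmod (f 0) + R + 1"
        "cmod z \<le> ln (cmod (f z)) powr (1 / \<alpha>)" "f z \<in> A" if "z \<in> G" for z
      proof -
        have z: "\<sigma> \<le> cmod z" "exp (cmod z powr \<alpha>) \<le> cmod (f z)" "f z \<in> A"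
          using that by (auto simp: G_def)
        show "cmod z > 0" "f z \<in> A" using z elim by auto
        have "0 < cmod (f z)" using z(2) exp_gt_zero less_le_trans by blast
        then have l: "cmod z powr \<alpha> \<le> ln (cmod (f z))" using z(2) by (simp add: ln_ge_iff)
        moreover have "\<sigma> powr \<alpha> \<le> cmod z powr \<alpha>" using z(1) elim \<alpha> by (intro powr_mono2) auto
        ultimately show l0': "ln (cmod (f z)) \<ge> l0" using elim by linarith
        show "cmod (f z) \<ge> 2 * cmod (f 0) + R + 1"
          using l0(3)[OF l0'] \<open>0 < cmod (f z)\<close> by simp
        have "(cmod z powr \<alpha>) powr (1 / \<alpha>) \<le> ln (cmod (f z)) powr (1 / \<alpha>)"
          using l \<alpha> by (intro powr_mono2) auto
        then show "cmod z \<le> ln (cmod (f z)) powr (1 / \<alpha>)"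
          using \<alpha> by (simp add: powr_powr)
      qed
      have fib: "finite {z \<in> G. f z = w} \<and> real (card {z \<in> G. f z = w}) \<le> 2 + C * ln (cmod w) powr q"
        if ne: "{z \<in> G. f z = w} \<noteq> {}" for w
      proof -
        obtain z where z: "z \<in> G" "f z = w" using ne by blast
        define l where "l = ln (cmod w)"
        define r where "r = l powr (1 / \<alpha>)"
        have l: "l \<ge> l0" "cmod w \<ge> 2 * cmod (f 0) + R + 1" using G[OF z(1)] z(2) by (auto simp: l_def)
        have r: "r > 0" using l0(4)[OF l(1)] by (simp add: r_def)
        have B: "max_modulus f (4 * r) \<le> exp ((4 * r) powr \<beta>)"
          using r1 l0(2)[OF l(1)] by (simp add: r_def)
        have w: "cmod w \<ge> 1" "cmod w \<ge> 2 * cmod (f 0)" using l(2) R norm_ge_zero[of "f 0"] by linarith+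
        note c = card_preimages_le_growth[OF hol r w B powr_ge_zero]
        have sub: "{z \<in> G. f z = w} \<subseteq> {z \<in> cball 0 r. f z = w}"
          using G(4) by (auto simp: r_def l_def)
        have "(4 * r) powr \<beta> = C * l powr q"
          using \<alpha> by (simp add: r_def C_def q_def powr_mult powr_powr)
        moreover have "real (card {z \<in> G. f z = w}) \<le> real (card {z \<in> cball 0 r. f z = w})"
          using card_mono[OF c(1) sub] by simp
        ultimately show ?thesis using c(2) finite_subset[OF sub c(1)] by (simp add: l_def)
      qed
      have "logarea G = (\<integral>\<^sup>+z. ennreal (1 / (cmod z)\<^sup>2) * indicator G z \<partial>lborel)"
        by (rule logarea_lborel)
      also have "\<dots> \<le> (\<integral>\<^sup>+z. ennreal (indicator G z * (cmod (deriv f z))\<^sup>2) * h (f z) \<partial>lborel)"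
      proof (rule nn_integral_mono)
        fix z
        show "ennreal (1 / (cmod z)\<^sup>2) * indicator G z \<le> ennreal (indicator G z * (cmod (deriv f z))\<^sup>2) * h (f z)"
        proof (cases "z \<in> G")
          case True
          note g = G[OF True]
          define w where "w = cmod (f z)"
          define l where "l = ln w"
          define D where "D = cmod (deriv f z)"
          have l: "l \<ge> 1" "l \<ge> 2 * ln R" using g(2) l0 by (auto simp: l_def w_def)
          have w: "w > R" "w > 0" using g(3) R norm_ge_zero[of "f 0"] unfolding w_def by linarith+
          have "w * (l - ln R) \<le> 84 * (cmod z * D)"
            using eremenko_lyubich_expansion[OF tr sv R, of z] w
            by (simp add: w_def l_def D_def norm_mult)
          moreover have "w * (l / 2) \<le> w * (l - ln R)" using l w by (intro mult_left_mono) auto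
          ultimately have "w * l \<le> 168 * (cmod z * D)" by simp
          then have "(w * l)\<^sup>2 \<le> (168 * (cmod z * D))\<^sup>2" using w l by (intro power_mono) auto
          then have "1 / (cmod z)\<^sup>2 \<le> D\<^sup>2 * (28224 / (w\<^sup>2 * l\<^sup>2))"
            using g(1) w l by (simp add: divide_simps power_mult_distrib mult_ac)
          then show ?thesis
            using True by (simp add: h_def D_def w_def l_def flip: ennreal_mult)
        qed simp
      qed
      also have "\<dots> \<le> (\<integral>\<^sup>+w. k w \<partial>lborel)"
      proof (rule nn_integral_holomorphic_le_multiplicity[OF hol Gb])
        show "deriv f z \<noteq> 0" if "z \<in> G" for z
          using deriv_nonzero_of_large[OF sv, of z] G(3)[OF that] norm_ge_zero[of "f 0"] by linarith
        show "h \<in> borel_measurable borel" unfolding h_def by measurable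
        show "finite {z \<in> G. f z = w}" for w using fib[of w] by (metis finite.emptyI)
        show "of_nat (card {z \<in> G. f z = w}) * h w \<le> k w" for w
        proof (cases "{z \<in> G. f z = w} = {}")
          case False
          then obtain z where z: "z \<in> G" "f z = w" by blast
          define n where "n = card {z \<in> G. f z = w}"
          define l where "l = ln (cmod w)"
          have l: "l \<ge> l0" "w \<in> A" "cmod w > 0" using G[OF z(1)] z(2) R by (auto simp: l_def)
          have "real n \<le> 2 + C * l powr q" using fib[OF False] by (simp add: n_def l_def)
          then have "56448 * real n \<le> 56448 * (2 + C * l powr q)" by simp
          also have "\<dots> \<le> l\<^sup>2" by (rule l0(1)[OF l(1)])
          finally have "56448 * real n \<le> l\<^sup>2" .
          then have "real n * (28224 / ((cmod w)\<^sup>2 * l\<^sup>2)) \<le> 1/2 * (1 / (cmod w)\<^sup>2)"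
            using l(3) l0(4)[OF l(1)] by (simp add: divide_simps)
          moreover have "of_nat n * h w = ennreal (real n * (28224 / ((cmod w)\<^sup>2 * l\<^sup>2)))"
            unfolding h_def l_def ennreal_of_nat_eq_real_of_nat by (rule ennreal_mult[symmetric]) auto
          moreover have "k w = ennreal (1/2) * ennreal (1 / (cmod w)\<^sup>2)"
            using l(2) by (simp only: k_def indicator_simps mult_1_right)
          then have "k w = ennreal (1/2 * (1 / (cmod w)\<^sup>2))"
            by (simp only: ennreal_mult[symmetric] zero_le_divide_1_iff zero_le_power2 zero_le_numeral)
          ultimately show ?thesis unfolding n_def[symmetric] by (metis ennreal_leI)
        qed (simp only: card.empty of_nat_0 mult_zero_left zero_le)
      qed
      also have "\<dots> = ennreal (1/2) * logarea A"
        unfolding k_def logarea_lborel by (rule nn_integral_cmult) measurable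
      finally show "logarea G \<le> ennreal (1/2) * logarea A" .
    qed
  qed
qed

section \<open>A sufficient condition for fast escape\<close>

text \<open>
  Compare the powers \<open>\<alpha>\<close> of the moduli along the orbit with the powers \<open>\<beta>\<close> of the iterated maximum moduli,
  up to a factor \<open>K\<close>. This comparison reproduces itself under exponentiation as soon as
  \<open>ln K + \<beta> \<le> \<alpha> * K\<close>, and it holds initially after sufficiently many steps because the
  orbit tends to infinity.
\<close>
lemma fast_escaping_of_iterated_growth:
  fixes f :: "complex \<Rightarrow> complex"
  assumes tr: "transcendental_entire f"
    and growth: "eventually (\<lambda>r. max_modulus f r \<le> exp (r powr \<beta>)) at_top"
    and \<alpha>: "0 < \<alpha>" "\<alpha> \<le> \<beta>"
    and step: "\<And>n. exp (cmod ((f ^^ n) z) powr \<alpha>) \<le> cmod ((f ^^ Suc n) z)"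
    and double: "\<And>n. 2 * cmod ((f ^^ n) z) \<le> cmod ((f ^^ Suc n) z)" and z: "cmod z > 0"
  shows "z \<in> fast_escaping_set f"
proof -
  have hol: "f holomorphic_on UNIV" using tr by (simp add: transcendental_entire_def)
  define x where "x = (\<lambda>n. cmod ((f ^^ n) z))"
  obtain r1 where r1: "\<And>r. r \<ge> r1 \<Longrightarrow> max_modulus f r \<le> exp (r powr \<beta>)"
    using growth by (auto simp: eventually_at_top_linorder)
  obtain R1 where R1: "admissible_radius f R1" using ex_admissible_radius[OF tr] by blast
  define R where "R = max R1 (max r1 1)"
  have adm: "admissible_radius f R" using R1 by (auto simp: admissible_radius_def R_def)
  define M where "M = (\<lambda>n. (max_modulus f ^^ n) R)"
  have MR: "M n \<ge> R" for n unfolding M_def by (rule iterate_max_modulus_ge[OF adm])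
  have M1: "M n \<ge> 1" for n using MR[of n] by (simp add: R_def)
  have Mstep: "M (Suc n) \<le> exp (M n powr \<beta>)" for n
    using r1[of "M n"] MR[of n] by (simp add: M_def R_def)
  have "eventually (\<lambda>K::real. ln K + \<beta> \<le> \<alpha> * K) at_top"
    using \<alpha>(1) by real_asymp
  then have "eventually (\<lambda>K::real. ln K + \<beta> \<le> \<alpha> * K \<and> 1 \<le> K) at_top"
    by (rule eventually_conj) (rule eventually_ge_at_top)
  then obtain K :: real where K: "ln K + \<beta> \<le> \<alpha> * K" "1 \<le> K"
    by (auto simp: eventually_at_top_linorder)
  have "x n \<ge> 2 ^ n * cmod z" for n
  proof (induction n)
    case (Suc n)
    then show ?case using double[of n] by (simp add: x_def)
  qed (simp add: x_def)
  moreover have "filterlim (\<lambda>n. 2 ^ n * cmod z) at_top sequentially" using z by real_asymp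
  ultimately have xtop: "filterlim x at_top sequentially"
    by (intro filterlim_at_top_mono[where g = x]) auto
  have "filterlim (\<lambda>n. x n powr \<alpha>) at_top sequentially"
    by (rule filterlim_compose[OF _ xtop]) (use \<alpha>(1) in real_asymp)
  then obtain L where L: "K * R powr \<beta> \<le> x L powr \<alpha>"
    by (auto simp: filterlim_at_top eventually_sequentially)
  have inv: "K * M k powr \<beta> \<le> x (L + k) powr \<alpha>" for k
  proof (induction k)
    case 0
    then show ?case using L by (simp add: M_def)
  next
    case (Suc k)
    define y where "y = M k powr \<beta>"
    have y: "1 \<le> y" unfolding y_def using M1[of k] \<alpha> by (intro ge_one_powr_ge_zero) auto
    have "M (Suc k) powr \<beta> \<le> exp y powr \<beta>"
      using Mstep[of k] M1[of "Suc k"] \<alpha> unfolding y_def by (intro powr_mono2) auto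
    then have "K * M (Suc k) powr \<beta> \<le> K * exp (\<beta> * y)"
      using K by (simp add: powr_def)
    also have "\<dots> = exp (ln K + \<beta> * y)" using K by (simp add: exp_add)
    also have "\<dots> \<le> exp (\<alpha> * (K * y))"
    proof -
      have "ln K + \<beta> * y \<le> ln K * y + \<beta> * y"
        using K y mult_left_mono[of 1 y "ln K"] by simp
      also have "\<dots> = (ln K + \<beta>) * y" by (simp add: algebra_simps)
      also have "\<dots> \<le> \<alpha> * K * y" using K y by (intro mult_right_mono) auto
      finally show ?thesis by (simp add: mult.assoc)
    qed
    also have "\<dots> \<le> exp (\<alpha> * x (L + k) powr \<alpha>)"
      using Suc \<alpha> by (simp add: y_def)
    also have "\<dots> = exp (x (L + k) powr \<alpha>) powr \<alpha>" by (simp add: powr_def)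
    also have "\<dots> \<le> x (L + Suc k) powr \<alpha>"
      using step[of "L + k"] \<alpha> by (intro powr_mono2) (auto simp: x_def)
    finally show ?case .
  qed
  have "(max_modulus f ^^ (n - L)) R \<le> cmod ((f ^^ n) z)" if "n > L" for n
  proof -
    define k where "k = n - L"
    have "M k powr \<alpha> \<le> M k powr \<beta>" using M1[of k] \<alpha> by (intro powr_mono) auto
    also have "\<dots> \<le> K * M k powr \<beta>"
      using K mult_right_mono[of 1 K "M k powr \<beta>"] by simp
    also have "\<dots> \<le> x (L + k) powr \<alpha>" by (rule inv)
    finally have "M k \<le> x (L + k)"
      using powr_less_mono2[OF \<alpha>(1), of "x (L + k)" "M k"] by (force simp: x_def)
    then show ?thesis using that by (simp add: M_def x_def k_def)
  qed
  then have "z \<in> fast_escaping_wrt f R" unfolding fast_escaping_wrt_def by blast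
  then show ?thesis using fast_escaping_set_eq[OF tr adm] by simp
qed

section \<open>The complement of the fast escaping set\<close>

theorem theorem1p4:
  fixes f :: "complex \<Rightarrow> complex" and \<rho> \<epsilon> :: real
  assumes "f \<in> eremenko_lyubich"
    and "growth_order f = ereal \<rho>"
    and "\<epsilon> > 0"
    and "logarea {z \<in> \<Delta>. cmod (f z) < exp (cmod z powr (\<rho> / 2 + \<epsilon>))} < \<infinity>"
  shows "logarea (\<Delta> - fast_escaping_set f) < \<infinity>"
proof -
  define \<alpha> where "\<alpha> = \<rho> / 2 + \<epsilon>"
  define \<beta> where "\<beta> = \<rho> + \<epsilon>"
  have tr: "transcendental_entire f" and bdd: "bounded (critical_values f \<union> asymptotic_values f)"
    using assms(1) by (auto simp: eremenko_lyubich_def)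
  have hol: "f holomorphic_on UNIV" using tr by (simp add: transcendental_entire_def)
  note [measurable] = borel_measurable_entire[OF hol]
  have \<rho>: "0 \<le> \<rho>" using growth_order_nonneg[OF tr] assms(2) by simp
  have \<alpha>\<beta>: "0 < \<alpha>" "0 < \<beta>" "\<beta> < 2 * \<alpha>" "\<alpha> \<le> \<beta>"
    using \<rho> assms(3) by (auto simp: \<alpha>_def \<beta>_def)
  obtain B where B: "\<And>w. w \<in> critical_values f \<union> asymptotic_values f \<Longrightarrow> cmod w \<le> B"
    using bdd unfolding bounded_iff by blast
  define R where "R = max B (cmod (f 0) + 1)"
  have sv: "singular_values_within f R"
    using B unfolding singular_values_within_def R_def by fastforce
  have R: "R > 0" "cmod (f 0) \<le> R" using norm_ge_zero[of "f 0"] unfolding R_def by linarith+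
  have growth: "eventually (\<lambda>r. max_modulus f r \<le> exp (r powr \<beta>)) at_top"
    by (rule max_modulus_le_of_growth_order[OF tr]) (use assms(2,3) in \<open>simp add: \<beta>_def\<close>)
  have "eventually (\<lambda>t::real. 2 * t \<le> exp (t powr \<alpha>)) at_top" using \<alpha>\<beta>(1) by real_asymp
  then have "eventually (\<lambda>\<sigma>::real. \<forall>t\<ge>\<sigma>. 2 * t \<le> exp (t powr \<alpha>)) at_top"
    by (rule eventually_all_ge_at_top)
  then have "eventually (\<lambda>\<sigma>. (\<forall>A \<in> sets borel.
      logarea {z. \<sigma> \<le> cmod z \<and> exp (cmod z powr \<alpha>) \<le> cmod (f z) \<and> f z \<in> A} \<le> ennreal (1/2) * logarea A) \<and>
      (\<forall>t\<ge>\<sigma>. 2 * t \<le> exp (t powr \<alpha>)) \<and> 1 \<le> \<sigma>) at_top"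
    using logarea_preimage_contraction[OF tr sv R growth \<alpha>\<beta>(1-3)] eventually_ge_at_top[of 1]
    by eventually_elim blast
  from eventually_happens'[OF trivial_limit_at_top_linorder this]
  obtain \<sigma> where contr: "\<And>A. A \<in> sets borel \<Longrightarrow>
      logarea {z. \<sigma> \<le> cmod z \<and> exp (cmod z powr \<alpha>) \<le> cmod (f z) \<and> f z \<in> A} \<le> ennreal (1/2) * logarea A"
    and double: "\<And>t. t \<ge> \<sigma> \<Longrightarrow> 2 * t \<le> exp (t powr \<alpha>)" and \<sigma>: "1 \<le> \<sigma>"
    by blast
  define G where "G = {z. \<sigma> \<le> cmod z \<and> exp (cmod z powr \<alpha>) \<le> cmod (f z)}"
  define W where "W = {z. \<sigma> \<le> cmod z \<and> cmod (f z) < exp (cmod z powr \<alpha>)}"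
  \<comment> \<open>The set \<open>T n\<close> consists of the points whose orbit stays good for \<open>n\<close> steps and then meets the
    bad set \<open>W\<close>.\<close>
  define T where "T = (\<lambda>n. ((\<lambda>A. G \<inter> f -` A) ^^ n) W)"
  have T0: "T 0 = W" and TS: "T (Suc n) = G \<inter> f -` T n" for n by (simp_all add: T_def)
  have Gb [measurable]: "G \<in> sets borel" unfolding G_def by measurable
  have Tb [measurable]: "T n \<in> sets borel" for n
  proof (induction n)
    case 0
    show ?case unfolding T0 W_def by measurable
  next
    case (Suc n)
    then show ?case unfolding TS
      using measurable_sets_borel[OF borel_measurable_entire[OF hol]] by (intro sets.Int Gb) auto
  qed
  have "W \<subseteq> {z \<in> \<Delta>. cmod (f z) < exp (cmod z powr (\<rho> / 2 + \<epsilon>))}"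
    using \<sigma> by (auto simp: W_def Delta_def \<alpha>_def)
  then have Wfin: "logarea W < \<infinity>" using logarea_mono assms(4) by (meson le_less_trans)
  have Tn: "logarea (T n) \<le> ennreal ((1/2) ^ n) * logarea W" for n
  proof (induction n)
    case 0
    show ?case by (simp add: T0)
  next
    case (Suc n)
    have "T (Suc n) = {z. \<sigma> \<le> cmod z \<and> exp (cmod z powr \<alpha>) \<le> cmod (f z) \<and> f z \<in> T n}"
      by (auto simp: TS G_def)
    then have "logarea (T (Suc n)) \<le> ennreal (1/2) * logarea (T n)"
      using contr[OF Tb[of n]] by simp
    also have "\<dots> \<le> ennreal (1/2) * (ennreal ((1/2) ^ n) * logarea W)"
      by (intro mult_left_mono Suc) simp
    also have "\<dots> = ennreal ((1/2) ^ Suc n) * logarea W"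
    proof -
      have "ennreal ((1/2) ^ Suc n) = ennreal (1/2) * ennreal ((1/2) ^ n)"
        unfolding power_Suc by (rule ennreal_mult) auto
      then show ?thesis by (simp only: mult.assoc)
    qed
    finally show ?case .
  qed
  have "logarea (\<Union>n. T n) \<le> (\<Sum>n. logarea (T n))" by (rule logarea_UN_le) measurable
  also have "\<dots> \<le> (\<Sum>n. ennreal ((1/2) ^ n) * logarea W)"
    by (intro suminf_le Tn) auto
  also have "\<dots> = (\<Sum>n. ennreal ((1/2) ^ n)) * logarea W" by (rule ennreal_suminf_multc)
  also have "(\<Sum>n. ennreal ((1/2) ^ n)) = ennreal 2"
    by (subst suminf_ennreal2) (simp_all add: suminf_geometric)
  also have "ennreal 2 * logarea W < \<infinity>" using Wfin by (simp add: ennreal_mult_less_top)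
  finally have fin: "logarea (\<Union>n. T n) < \<infinity>" .
  have "z \<in> fast_escaping_set f" if z: "\<sigma> \<le> cmod z" "z \<notin> (\<Union>n. T n)" for z
  proof -
    have orbit: "\<sigma> \<le> cmod ((f ^^ n) z) \<and> (\<forall>m. (f ^^ n) z \<notin> T m)" for n
    proof (induction n)
      case 0
      then show ?case using z by auto
    next
      case (Suc n)
      let ?y = "(f ^^ n) z"
      have "?y \<in> G" using Suc T0 by (auto simp: W_def G_def not_less)
      then have "exp (cmod ?y powr \<alpha>) \<le> cmod (f ?y)" by (simp add: G_def)
      then have "\<sigma> \<le> cmod (f ?y)" using double[of "cmod ?y"] Suc \<sigma> by linarith
      moreover have "f ?y \<notin> T m" for m using Suc TS[of m] \<open>?y \<in> G\<close> by auto
      ultimately show ?case by simp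
    qed
    have step: "exp (cmod ((f ^^ n) z) powr \<alpha>) \<le> cmod ((f ^^ Suc n) z)" for n
      using orbit[of n] T0 by (force simp: W_def not_less)
    show ?thesis
    proof (rule fast_escaping_of_iterated_growth[OF tr growth \<alpha>\<beta>(1,4) step])
      show "2 * cmod ((f ^^ n) z) \<le> cmod ((f ^^ Suc n) z)" for n
        using order_trans[OF double step[of n]] orbit[of n] by blast
    qed (use z \<sigma> in auto)
  qed
  then have "\<Delta> - fast_escaping_set f \<subseteq> {z \<in> \<Delta>. cmod z < \<sigma>} \<union> (\<Union>n. T n)"
    by force
  then have "logarea (\<Delta> - fast_escaping_set f) \<le> logarea ({z \<in> \<Delta>. cmod z < \<sigma>} \<union> (\<Union>n. T n))"
    by (rule logarea_mono)
  also have "\<dots> \<le> logarea {z \<in> \<Delta>. cmod z < \<sigma>} + logarea (\<Union>n. T n)"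
  proof (rule logarea_Un_le)
    show "{z \<in> \<Delta>. cmod z < \<sigma>} \<in> sets borel" unfolding Delta_def by measurable
  qed measurable
  also have "\<dots> < \<infinity>" using logarea_bounded_annulus_finite fin by simp
  finally show ?thesis .
qed

end
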